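(* Let $\nu>-1$ and let $f_\nu$ denote the function $$f_\nu(z)=2^{2\nu}z^{-\frac{\nu}{2}+\frac{3}{4}}\,\Gamma(\nu+1)\Gamma(\nu+2)\left(J_{\nu+1}(\sqrt[4]{z})\, I_{\nu}(\sqrt[4]{z}) + J_\nu(\sqrt[4]{z})\,I_{\nu+1}(\sqrt[4]{z})\right).$$ The equation in the unknown $\nu$ $$(\nu-1)J_{\nu}(1)I_{\nu+1}(1)+(\nu-1)J_{\nu+1}(1)I_{\nu}(1)=J_{\nu}(1)I_{\nu}(1)$$ has a unique root $\nu^{\ast}\simeq-0.9427\dots$ on $(-1,\infty)$, and $f_\nu$ is starlike in $\mathbb{D}$ and all of its derivatives are close-to-convex (and hence univalent) in $\mathbb{D}$ if and only if $\nu\geq\nu^{\ast}$.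
   Context: $J_\nu$ and $I_\nu$ are the Bessel and modified Bessel functions of the first kind of order $\nu$, $\Gamma$ is the Euler gamma function, and $\mathbb{D}=\{z\in\mathbb{C}:|z|<1\}$. The fractional powers in $f_\nu$ are taken with consistent branches (that is, $z^{-\nu/2+3/4}=z\,(\sqrt[4]{z})^{-2\nu-1}$); the branch factors cancel, and $f_\nu$ is understood as the resulting entire function, with $f_\nu(0)=0$ and $f_\nu'(0)=1$. An analytic function $f$ on $\mathbb{D}$ with $f(0)=0$ is starlike in $\mathbb{D}$ if it is univalent there and $f(\mathbb{D})$ is starlike with respect to the origin. An analytic function $f$ on $\mathbb{D}$ is close-to-convex in $\mathbb{D}$ if there is a univalent analytic function $g$ on $\mathbb{D}$ with convex image $g(\mathbb{D})$ such that $\operatorname{Re}\left(f'(z)/g'(z)\right)>0$ for all $z\in\mathbb{D}$ (no normalization is imposed). "All of its derivatives" means $f^{(k)}$ for all $k\geq 1$. *)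

theory Defs
  imports "HOL-Analysis.Analysis"
begin

text \<open>
  The Bessel function and the modified Bessel function of the first kind, with
  \<^term>\<open>(z / 2) powr \<nu>\<close> on the principal branch. The reciprocal Gamma function \<^term>\<open>rGamma\<close>
  makes the series correct at the poles of \<^term>\<open>Gamma\<close>. The case \<^term>\<open>\<nu> = 0\<close> is separated
  because \<^term>\<open>0 powr 0 = 0\<close>, whereas the functions of order 0 take the value 1 at 0.
\<close>

definition Bessel_J :: "complex \<Rightarrow> complex \<Rightarrow> complex" where
  "Bessel_J \<nu> z = (if \<nu> = 0 then 1 else (z / 2) powr \<nu>) *
     (\<Sum>n. (- 1) ^ n * rGamma (\<nu> + of_nat n + 1) / fact n * (z / 2) ^ (2 * n))"

definition Bessel_I :: "complex \<Rightarrow> complex \<Rightarrow> complex" where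
  "Bessel_I \<nu> z = (if \<nu> = 0 then 1 else (z / 2) powr \<nu>) *
     (\<Sum>n. rGamma (\<nu> + of_nat n + 1) / fact n * (z / 2) ^ (2 * n))"

text \<open>
  All powers are principal, so \<^term>\<open>z powr (3/4 - \<nu>/2) = z * (z powr (1/4)) powr (- 2*\<nu> - 1)\<close>
  and the branch factors cancel for every nonzero \<^term>\<open>z\<close>, also on the negative real axis
  (see \<open>f_fun_nonzero\<close> below). The value at 0 is the one that makes the function entire.
\<close>

definition f_fun :: "real \<Rightarrow> complex \<Rightarrow> complex" where
  "f_fun \<nu> z = (if z = 0 then 0 else
     (let w = z powr (1/4) in
        of_real (2 powr (2 * \<nu>)) * z powr (of_real (- \<nu> / 2 + 3/4)) *
        of_real (Gamma (\<nu> + 1) * Gamma (\<nu> + 2)) *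
        (Bessel_J (of_real (\<nu> + 1)) w * Bessel_I (of_real \<nu>) w +
         Bessel_J (of_real \<nu>) w * Bessel_I (of_real (\<nu> + 1)) w)))"

definition starlike_on_disc :: "(complex \<Rightarrow> complex) \<Rightarrow> bool" where
  "starlike_on_disc f \<longleftrightarrow>
     f holomorphic_on ball 0 1 \<and> f 0 = 0 \<and> inj_on f (ball 0 1) \<and>
     (\<forall>w \<in> f ` ball 0 1. closed_segment 0 w \<subseteq> f ` ball 0 1)"

definition close_to_convex_on_disc :: "(complex \<Rightarrow> complex) \<Rightarrow> bool" where
  "close_to_convex_on_disc f \<longleftrightarrow>
     f holomorphic_on ball 0 1 \<and>
     (\<exists>g. g holomorphic_on ball 0 1 \<and> inj_on g (ball 0 1) \<and> convex (g ` ball 0 1) \<and>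
          (\<forall>z \<in> ball 0 1. Re (deriv f z / deriv g z) > 0))"

lemma powr_quarter_half:
  fixes z a :: complex
  assumes "z \<noteq> 0"
  shows "(z powr (1/4) / 2) powr a = z powr (a / 4) * 2 powr (- a)"
proof -
  have L: "Ln (z powr (1/4)) = Ln z / 4"
    using assms mpi_less_Im_Ln[of z] Im_Ln_le_pi[of z] by (simp add: powr_def)
  have "Ln (z powr (1/4) / 2) = Ln z / 4 - Ln 2"
    using Ln_divide_of_real[of 2 "z powr (1/4)"] assms L by (simp add: Ln_of_real[of 2, simplified])
  then have "(z powr (1/4) / 2) powr a = exp (a * (Ln z / 4 - Ln 2))"
    using assms by (simp only: powr_def) simp
  also have "\<dots> = exp (a / 4 * Ln z) * exp (- a * Ln 2)"
    by (simp add: exp_add[symmetric] algebra_simps)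
  finally show ?thesis
    using assms by (simp add: powr_def)
qed

lemma f_fun_nonzero:
  fixes z :: complex and \<nu> :: real
  defines "j \<equiv> \<lambda>a::complex. \<Sum>n. (- 1) ^ n * rGamma (a + of_nat n + 1) / fact n * (z powr (1/4) / 2) ^ (2 * n)"
    and "i \<equiv> \<lambda>a::complex. \<Sum>n. rGamma (a + of_nat n + 1) / fact n * (z powr (1/4) / 2) ^ (2 * n)"
  assumes "z \<noteq> 0"
  shows "f_fun \<nu> z = z / 2 * of_real (Gamma (\<nu> + 1) * Gamma (\<nu> + 2)) * (j (\<nu> + 1) * i \<nu> + j \<nu> * i (\<nu> + 1))"
proof -
  define w where "w = z powr (1/4)"
  have w: "w \<noteq> 0" using assms by (simp add: w_def)
  have one: "(if a = 0 then 1 else (w / 2) powr a) = (w / 2) powr a" for a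
    using w by simp
  have p: "of_real (2 powr (2 * \<nu>)) * z powr (of_real (- \<nu> / 2 + 3/4)) * ((w / 2) powr (\<nu> + 1) * (w / 2) powr \<nu>) = z / 2"
    (is "?l = _")
  proof -
    have c: "complex_of_real (2 powr (2 * \<nu>)) = 2 powr (2 * of_real \<nu>)"
      using powr_of_real[of 2 "2 * \<nu>"] by simp
    have "?l = exp ((2 * of_real \<nu>) * Ln 2) * exp ((- of_real \<nu> / 2 + 3/4) * Ln z) *
        ((exp ((of_real \<nu> + 1) / 4 * Ln z) * exp (- (of_real \<nu> + 1) * Ln 2)) *
         (exp (of_real \<nu> / 4 * Ln z) * exp (- of_real \<nu> * Ln 2)))"
      unfolding w_def powr_quarter_half[OF assms(3)] c
      using assms by (simp add: powr_def)
    also have "\<dots> = exp (Ln z - Ln 2)"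
      unfolding exp_add[symmetric] by (rule arg_cong[where f = exp]) (simp add: field_simps)
    also have "\<dots> = z / 2" using assms by (simp add: exp_diff)
    finally show ?thesis .
  qed
  have "f_fun \<nu> z = (of_real (2 powr (2 * \<nu>)) * z powr (of_real (- \<nu> / 2 + 3/4)) * ((w / 2) powr (\<nu> + 1) * (w / 2) powr \<nu>)) *
    of_real (Gamma (\<nu> + 1) * Gamma (\<nu> + 2)) * (j (\<nu> + 1) * i \<nu> + j \<nu> * i (\<nu> + 1))"
    using assms(3) unfolding f_fun_def Let_def Bessel_J_def Bessel_I_def w_def[symmetric] one j_def i_def
    by (simp add: algebra_simps)
  then show ?thesis unfolding p by simp
qed

end

theory Submission
  imports Defs "HOL-Complex_Analysis.Complex_Analysis"
begin

text \<open>
  The function \<open>f\<^sub>\<nu>\<close> is entire with the alternating expansion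
  \<open>f\<^sub>\<nu>(z) = z - c\<^sub>1 z\<^sup>2 + c\<^sub>2 z\<^sup>3 - ...\<close>, where
  \<open>c\<^sub>n = 1 / (16^n n! (\<nu>+1)\<^sub>n (\<nu>+2)\<^sub>2\<^sub>n)\<close> (\<open>f_fun_eq_series\<close>). This comes from the
  cross product \<open>J\<^sub>\<nu>\<^sub>+\<^sub>1 I\<^sub>\<nu> + J\<^sub>\<nu> I\<^sub>\<nu>\<^sub>+\<^sub>1\<close>: four products of Bessel functions
  satisfy a first order linear system, and comparing coefficients in that system gives a two-term
  recurrence that can be solved explicitly. The same system turns the transcendental equation for
  \<open>\<nu>\<close> into \<open>f\<^sub>\<nu>'(1) = 0\<close> (\<open>bessel_equation_iff\<close>).

  For \<open>\<nu> > -1\<close> the coefficients after \<open>c\<^sub>1\<close> fall by a factor of at least \<open>384\<close> at every step.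
  Only this decay matters for the geometry of \<open>f = f\<^sub>\<nu>\<close>, and it makes every function involved
  a small perturbation of a polynomial of degree at most two.

  \<^item> For \<open>k \<ge> 1\<close> the constant term dominates in the expansion of \<open>f^(k+1)\<close>, which therefore stays
    in a half-plane. So \<open>f^(k)\<close> is close-to-convex with a linear comparison function, whatever
    \<open>\<nu>\<close> is.

  \<^item> On the unit disc \<open>Re f'(z) > f'(1)\<close>, because \<open>f'(z)\<close> is close to \<open>1 - 2 c\<^sub>1 z\<close> and
    \<open>Re (1 - z^n) \<le> n\<^sup>2 Re (1 - z)\<close> controls the remaining terms. If \<open>f'(1) \<ge> 0\<close>, then \<open>f\<close> is
    univalent by the Noshiro-Warschawski criterion. A comparison of \<open>f(z)/z\<close> with
    \<open>-(f(z)/z)'\<close> by the same inequality gives \<open>Re (z f'(z) / f(z)) > 0\<close>, hence starlikeness. If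
    \<open>f'(1) < 0\<close>, then \<open>f'\<close> has a zero in \<open>(0,1)\<close>, since \<open>f'(0) = 1\<close>, and \<open>f\<close> is not
    univalent. Thus \<open>f\<close> is starlike iff \<open>f'(1) \<ge> 0\<close> (\<open>starlike_eval_series_iff\<close>).

  It remains to study \<open>f\<^sub>\<nu>'(1) = 1 - t\<^sub>1 + t\<^sub>2 - ...\<close> as a function of \<open>\<nu>\<close>. Each pair
  \<open>t\<^sub>n - t\<^sub>n\<^sub>+\<^sub>1\<close> with \<open>n\<close> odd is strictly decreasing, because \<open>t\<^sub>n\<close> falls at least like
  \<open>1/(\<nu>+1)\<close> and \<open>t\<^sub>n\<^sub>+\<^sub>1\<close> is negligible. Hence \<open>f\<^sub>\<nu>'(1)\<close> is strictly increasing
  (\<open>cross_deriv_at_1_strict_mono\<close>), and three terms of the series locate its zero.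
\<close>

section \<open>Products of Bessel functions as power series\<close>

text \<open>
  With \<open>x = (z/2)\<^sup>2\<close>, the series for \<open>s = -1\<close> and \<open>s = 1\<close> are \<open>(z/2)^(-a) J\<^sub>a(z)\<close> and
  \<open>(z/2)^(-a) I\<^sub>a(z)\<close>. Treating both signs at once avoids duplicating the rules for
  differentiation and for the order.
\<close>

definition bessel_fps :: "complex \<Rightarrow> complex \<Rightarrow> complex fps" where
  "bessel_fps s a = Abs_fps (\<lambda>n. s ^ n * rGamma (a + of_nat n + 1) / fact n)"

lemma fps_deriv_bessel_fps: "fps_deriv (bessel_fps s a) = fps_const s * bessel_fps s (a + 1)"
  by (rule fps_ext) (simp add: bessel_fps_def add_ac field_simps del: of_nat_Suc, simp add: add_ac)

lemma rGamma_shift: "rGamma (a + of_nat n + 1) = (a + of_nat n + 1) * rGamma (a + 1 + of_nat n + 1)"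
  for a :: complex
  using rGamma_plus1[of "a + of_nat n + 1"] by (simp add: add_ac)

text \<open>
  This is the three-term recurrence of the Bessel functions with the order \<open>a + 2\<close> eliminated by
  \<open>fps_deriv_bessel_fps\<close>; orders \<open>a\<close> and \<open>a + 1\<close> then form a closed system.
\<close>

lemma bessel_fps_X_deriv:
  "fps_X * fps_deriv (bessel_fps s (a + 1)) = bessel_fps s a - fps_const (a + 1) * bessel_fps s (a + 1)"
proof (rule fps_ext)
  fix n
  have "fps_nth (fps_X * fps_deriv (bessel_fps s (a + 1))) n = of_nat n * fps_nth (bessel_fps s (a + 1)) n"
    by (cases n) auto
  also have "\<dots> = fps_nth (bessel_fps s a - fps_const (a + 1) * bessel_fps s (a + 1)) n"
  proof -
    define g where "g = rGamma (a + 1 + of_nat n + 1)"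
    have "fps_nth (bessel_fps s (a + 1)) n = s ^ n * g / fact n"
      by (simp add: bessel_fps_def g_def)
    moreover have "fps_nth (bessel_fps s a) n = s ^ n * ((a + of_nat n + 1) * g) / fact n"
      by (simp only: bessel_fps_def fps_nth_Abs_fps rGamma_shift[of a n] g_def)
    moreover have "of_nat n * u = (a + of_nat n + 1) * u - (a + 1) * u" for u :: complex
      by (simp add: algebra_simps)
    from this[of "s ^ n * g / fact n"]
    have "of_nat n * (s ^ n * g / fact n) = s ^ n * ((a + of_nat n + 1) * g) / fact n - (a + 1) * (s ^ n * g / fact n)"
      by (simp only: times_divide_eq_right mult.left_commute)
    ultimately show ?thesis
      by (simp only: fps_sub_nth fps_mult_left_const_nth)
  qed
  finally show "fps_nth (fps_X * fps_deriv (bessel_fps s (a + 1))) n = 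
      fps_nth (bessel_fps s a - fps_const (a + 1) * bessel_fps s (a + 1)) n" .
qed

text \<open>
  The restriction on \<open>a\<close> keeps the arguments away from the zeros of the reciprocal Gamma function,
  so that the ratio test applies.
\<close>

lemma fps_conv_radius_bessel_fps:
  assumes "Re a > -1"
  shows "fps_conv_radius (bessel_fps s a) = \<infinity>"
proof (cases "s = 0")
  case True
  have "bessel_fps s a = fps_const (rGamma (a + 1))"
    using True by (intro fps_ext) (simp add: bessel_fps_def power_0_left)
  then show ?thesis by simp
next
  case False
  have nz: "rGamma (a + of_nat n + 1) \<noteq> 0" for n
  proof -
    have "Re (a + of_nat n + 1) > 0" using assms by simp
    then have "a + of_nat n + 1 \<notin> \<int>\<^sub>\<le>\<^sub>0"
      by (auto elim!: nonpos_Ints_cases' dest!: arg_cong[where f = Re])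
    then show ?thesis by (simp add: rGamma_eq_zero_iff)
  qed
  have "(\<lambda>n. norm (fps_nth (bessel_fps s a) n) / norm (fps_nth (bessel_fps s a) (Suc n)))
      = (\<lambda>n. norm (a + of_nat n + 1) * (real n + 1) / norm s)"
  proof
    fix n
    have "fps_nth (bessel_fps s a) n * s = fps_nth (bessel_fps s a) (Suc n) * ((a + of_nat n + 1) * (of_nat n + 1))"
    proof -
      have alg: "s ^ n * (x * g) / F * s = s * s ^ n * g / (y * F) * (x * y)" if "y \<noteq> 0" for x g F y :: complex
        using that by (cases "F = 0") (simp_all add: field_simps)
      have "of_nat n + (1 :: complex) \<noteq> 0"
        using of_nat_neq_0[of n, where ?'a = complex] by (simp add: add.commute)
      moreover have "fact (Suc n) = (of_nat n + 1) * (fact n :: complex)"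
        by (simp add: algebra_simps)
      moreover have "a + of_nat (Suc n) + 1 = a + 1 + of_nat n + 1" by simp
      ultimately show ?thesis
        unfolding bessel_fps_def fps_nth_Abs_fps rGamma_shift[of a n] power_Suc
        by (simp only: alg)
    qed
    moreover have "fps_nth (bessel_fps s a) (Suc n) \<noteq> 0"
      using nz[of "Suc n"] False by (simp add: bessel_fps_def del: of_nat_Suc fact_Suc)
    ultimately have "fps_nth (bessel_fps s a) n / fps_nth (bessel_fps s a) (Suc n)
        = (a + of_nat n + 1) * (of_nat n + 1) / s"
      using False of_nat_neq_0[of n, where ?'a = complex] by (simp add: field_simps del: of_nat_neq_0)
    then show "norm (fps_nth (bessel_fps s a) n) / norm (fps_nth (bessel_fps s a) (Suc n))
      = norm (a + of_nat n + 1) * (real n + 1) / norm s"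
      by (metis (no_types) norm_divide norm_mult norm_of_nat of_nat_Suc of_nat_1 add.commute)
  qed
  moreover have "filterlim (\<lambda>n. norm (a + of_nat n + 1) * (real n + 1) / norm s) at_top sequentially"
  proof (rule filterlim_at_top_mono)
    show "filterlim (\<lambda>n. real n * 1 / norm s) at_top sequentially"
      using filterlim_tendsto_pos_mult_at_top[OF tendsto_const _ filterlim_real_sequentially, of "1 / norm s"] False
      by simp
  next
    have "real n * (1::real) \<le> norm (a + of_nat n + 1) * (real n + 1)" for n
    proof -
      have "real n \<le> Re (a + of_nat n + 1)" using assms by simp
      also have "\<dots> \<le> norm (a + of_nat n + 1)" by (rule complex_Re_le_cmod)
      finally have "real n * 1 \<le> norm (a + of_nat n + 1) * 1" by simp
      also have "\<dots> \<le> norm (a + of_nat n + 1) * (real n + 1)"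
        by (intro mult_left_mono) auto
      finally show ?thesis .
    qed
    then show "\<forall>\<^sub>F n in sequentially. real n * 1 / norm s \<le> norm (a + of_nat n + 1) * (real n + 1) / norm s"
      by (intro always_eventually allI divide_right_mono) auto
  qed
  ultimately have "(\<lambda>n. ereal (norm (fps_nth (bessel_fps s a) n) / norm (fps_nth (bessel_fps s a) (Suc n)))) \<longlonglongrightarrow> \<infinity>"
    by (simp add: tendsto_PInfty_eq_at_top)
  then show ?thesis unfolding fps_conv_radius_def
    by (intro conv_radius_ratio_limit_ereal_nonzero) auto
qed

definition bessel_product :: "complex \<Rightarrow> complex fps" where
  "bessel_product a = bessel_fps (-1) a * bessel_fps 1 a"

definition bessel_cross_product :: "complex \<Rightarrow> complex fps" where
  "bessel_cross_product a =
     bessel_fps (-1) (a + 1) * bessel_fps 1 a + bessel_fps (-1) a * bessel_fps 1 (a + 1)"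

lemma fps_nth_X_deriv: "fps_nth (fps_X * fps_deriv F) n = of_nat n * fps_nth F n"
  for F :: "complex fps"
  by (cases n) auto

text \<open>
  Coefficient form of \<open>x B' + (a + 1) B = 2 A\<close> for the product \<open>A\<close> and the cross product \<open>B\<close>. It
  serves twice: for the coefficients of \<open>B\<close>, and for rewriting the equation in \<open>\<nu>\<close> as a condition
  on the derivative of \<open>f\<^sub>\<nu>\<close>.
\<close>

lemma bessel_product_nth_eq_cross_product_nth:
  "2 * fps_nth (bessel_product a) m = (of_nat m + a + 1) * fps_nth (bessel_cross_product a) m"
proof -
  let ?j = "bessel_fps (-1) a" and ?i = "bessel_fps 1 a"
  let ?j' = "bessel_fps (-1) (a + 1)" and ?i' = "bessel_fps 1 (a + 1)"
  have d: "fps_deriv ?i = ?i'" "fps_deriv ?j = - ?j'"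
    by (simp_all add: fps_deriv_bessel_fps fps_const_neg[symmetric] del: fps_const_neg)
  have "fps_X * fps_deriv (bessel_cross_product a) = 
      (fps_X * fps_deriv ?j') * ?i + fps_X * ?j' * fps_deriv ?i
      + ?j * (fps_X * fps_deriv ?i') + fps_X * fps_deriv ?j * ?i'"
    by (simp add: bessel_cross_product_def algebra_simps)
  also have "\<dots> = 2 * bessel_product a - fps_const (a + 1) * bessel_cross_product a"
    unfolding bessel_fps_X_deriv d
    by (simp add: bessel_cross_product_def bessel_product_def algebra_simps)
  finally have "fps_X * fps_deriv (bessel_cross_product a)
     = fps_const 2 * bessel_product a - fps_const (a + 1) * bessel_cross_product a"
    by (simp add: numeral_fps_const)
  then have "fps_nth (fps_X * fps_deriv (bessel_cross_product a)) m
     = fps_nth (fps_const 2 * bessel_product a - fps_const (a + 1) * bessel_cross_product a) m"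
    by simp
  then show ?thesis
    unfolding fps_nth_X_deriv by (simp add: algebra_simps)
qed

text \<open>
  The products \<open>A = j i\<close>, \<open>B = j' i + j i'\<close>, \<open>C = j i' - j' i\<close> and \<open>E = j' i'\<close>, where the primed
  factors have order \<open>a + 1\<close>, satisfy the linear system \<open>A' = C\<close>, \<open>x B' + (a+1) B = 2 A\<close>,
  \<open>x C' + (a+1) C = -2 x E\<close>, \<open>x E' + 2 (a+1) E = B\<close>. Going once around it expresses a coefficient
  of \<open>A\<close> by the one two places before.
\<close>

lemma bessel_product_recurrence:
  "(of_nat m + 2) * (of_nat m + a + 2) * (of_nat m + 2 * a + 2) * (of_nat m + a + 1)
      * fps_nth (bessel_product a) (m + 2) = - 4 * fps_nth (bessel_product a) m"
  and bessel_product_nth_1: "(a + 1) * fps_nth (bessel_product a) 1 = 0"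
proof -
  let ?j = "bessel_fps (-1) a" and ?i = "bessel_fps 1 a"
  let ?j' = "bessel_fps (-1) (a + 1)" and ?i' = "bessel_fps 1 (a + 1)"
  let ?A = "bessel_product a" and ?B = "bessel_cross_product a"
  define C where "C = ?j * ?i' - ?j' * ?i"
  define E where "E = ?j' * ?i'"
  have d: "fps_deriv ?i = ?i'" "fps_deriv ?j = - ?j'"
    by (simp_all add: fps_deriv_bessel_fps fps_const_neg[symmetric] del: fps_const_neg)
  have A: "fps_deriv ?A = C"
    by (simp add: bessel_product_def C_def d)
  have "fps_X * fps_deriv C = ?j * (fps_X * fps_deriv ?i') + fps_X * fps_deriv ?j * ?i'
       - (fps_X * fps_deriv ?j') * ?i - fps_X * ?j' * fps_deriv ?i"
    by (simp add: C_def algebra_simps)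
  also have "\<dots> = - fps_const 2 * (fps_X * E) - fps_const (a + 1) * C"
    unfolding bessel_fps_X_deriv d by (simp add: C_def E_def algebra_simps numeral_fps_const[symmetric])
  finally have C: "fps_X * fps_deriv C = - fps_const 2 * (fps_X * E) - fps_const (a + 1) * C" .
  have "fps_X * fps_deriv E = ?j' * (fps_X * fps_deriv ?i') + (fps_X * fps_deriv ?j') * ?i'"
    by (simp add: E_def algebra_simps)
  also have "\<dots> = ?B - fps_const (2 * (a + 1)) * E"
    unfolding bessel_fps_X_deriv
    by (simp add: bessel_cross_product_def E_def algebra_simps numeral_fps_const[symmetric] 
       fps_const_mult[symmetric] fps_const_add[symmetric] del: fps_const_mult fps_const_add)
  finally have E: "fps_X * fps_deriv E = ?B - fps_const (2 * (a + 1)) * E" .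
  have An: "(of_nat n + 1) * fps_nth ?A (Suc n) = fps_nth C n" for n
    using arg_cong[OF A, of "\<lambda>F. fps_nth F n"] by (simp add: add.commute)
  have Cn: "(of_nat n + a + 1) * fps_nth C n = - 2 * (if n = 0 then 0 else fps_nth E (n - 1))" for n
  proof -
    have "of_nat n * fps_nth C n = - 2 * (if n = 0 then 0 else fps_nth E (n - 1)) - (a + 1) * fps_nth C n"
      unfolding fps_nth_X_deriv[symmetric] C by (simp del: fps_const_neg)
    then show ?thesis by (simp add: algebra_simps)
  qed
  have En: "(of_nat n + 2 * a + 2) * fps_nth E n = fps_nth ?B n" for n
    using arg_cong[OF E, of "\<lambda>F. fps_nth F n"] unfolding fps_nth_X_deriv
    by (simp add: algebra_simps)
  show "(a + 1) * fps_nth ?A 1 = 0"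
    using An[of 0] Cn[of 0] by simp
  have 1: "(of_nat m + 2) * fps_nth ?A (m + 2) = fps_nth C (Suc m)"
    using An[of "Suc m"] by (simp add: add.commute)
  have 2: "(of_nat m + a + 2) * fps_nth C (Suc m) = - 2 * fps_nth E m"
    using Cn[of "Suc m"] by (simp add: add_ac)
  have 3: "(of_nat m + 2 * a + 2) * fps_nth E m = fps_nth ?B m"
    by (rule En)
  have 4: "(of_nat m + a + 1) * fps_nth ?B m = 2 * fps_nth ?A m"
    using bessel_product_nth_eq_cross_product_nth[of a m] by simp
  have "(of_nat m + 2) * (of_nat m + a + 2) * (of_nat m + 2 * a + 2) * (of_nat m + a + 1)
      * fps_nth ?A (m + 2) =
     (of_nat m + 2 * a + 2) * (of_nat m + a + 1) * ((of_nat m + a + 2) * ((of_nat m + 2) * fps_nth ?A (m + 2)))"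
    by (simp only: mult_ac)
  also have "\<dots> = - 2 * ((of_nat m + a + 1) * ((of_nat m + 2 * a + 2) * fps_nth E m))"
    unfolding 1 2 by (simp only: mult_ac)
  also have "\<dots> = - 4 * fps_nth ?A m"
    unfolding 3 4 by simp
  finally show "(of_nat m + 2) * (of_nat m + a + 2) * (of_nat m + 2 * a + 2) * (of_nat m + a + 1)
      * fps_nth ?A (m + 2) = - 4 * fps_nth ?A m" .
qed

lemma Re_gt_imp_nonzero: "Re z > 0 \<Longrightarrow> z \<noteq> 0"
  by auto

lemma bessel_product_odd:
  assumes "Re a > -1"
  shows "fps_nth (bessel_product a) (2 * n + 1) = 0"
proof (induction n)
  case 0
  have "a + 1 \<noteq> 0" using assms by (intro Re_gt_imp_nonzero) simp
  then show ?case using bessel_product_nth_1[of a] by simp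
next
  case (Suc n)
  let ?m = "of_nat (2 * n + 1) :: complex"
  have "?m + 2 \<noteq> 0" "?m + a + 2 \<noteq> 0" "?m + 2 * a + 2 \<noteq> 0" "?m + a + 1 \<noteq> 0"
    using assms by (intro Re_gt_imp_nonzero; simp)+
  then have "fps_nth (bessel_product a) (2 * n + 1 + 2) = 0"
    using bessel_product_recurrence[of "2 * n + 1" a] Suc by (simp only: mult_zero_right mult_eq_0_iff) blast
  moreover have "2 * Suc n + 1 = 2 * n + 1 + 2" by simp
  ultimately show ?case by (simp only:)
qed

lemma bessel_product_even:
  assumes "Re a > -1"
  shows "fps_nth (bessel_product a) (2 * n) =
    (-1) ^ n * rGamma (a + of_nat n + 1) * rGamma (a + of_nat (2 * n) + 1) / fact n"
proof (induction n)
  case 0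
  show ?case by (simp add: bessel_product_def bessel_fps_def)
next
  case (Suc n)
  let ?m = "of_nat (2 * n) :: complex"
  let ?N = "of_nat n :: complex"
  have nz: "?N + 1 \<noteq> 0" "?m + a + 2 \<noteq> 0" "?N + a + 1 \<noteq> 0" "?m + a + 1 \<noteq> 0"
    using assms by (intro Re_gt_imp_nonzero; simp)+
  have r1: "rGamma (a + ?N + 1) = (?N + a + 1) * rGamma (a + of_nat (Suc n) + 1)"
    using rGamma_shift[of a n] by (simp add: add_ac)
  have r2: "rGamma (a + ?m + 1) = (?m + a + 1) * ((?m + a + 2) * rGamma (a + of_nat (2 * Suc n) + 1))"
    using rGamma_shift[of a "2 * n"] rGamma_shift[of a "2 * n + 1"] by (simp add: add_ac)
  have fn: "fact (Suc n) = (?N + 1) * (fact n :: complex)"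
    by (simp add: algebra_simps)
  have "(4 * (?N + 1) * (?m + a + 2) * (?N + a + 1) * (?m + a + 1)) * fps_nth (bessel_product a) (2 * Suc n)
     = (?m + 2) * (?m + a + 2) * (?m + 2 * a + 2) * (?m + a + 1) * fps_nth (bessel_product a) (2 * n + 2)"
    by (simp add: algebra_simps)
  also have "\<dots> = - 4 * ((-1) ^ n * rGamma (a + ?N + 1) * rGamma (a + ?m + 1) / fact n)"
    by (simp only: bessel_product_recurrence Suc)
  also have "\<dots> = (4 * (?N + 1) * (?m + a + 2) * (?N + a + 1) * (?m + a + 1)) *
     ((-1) ^ Suc n * rGamma (a + of_nat (Suc n) + 1) * rGamma (a + of_nat (2 * Suc n) + 1) / fact (Suc n))"
  proof -
    have "- 4 * (s * (x * p) * (y * (z * q)) / F) = (4 * w * z * x * y) * ((- 1 * s) * p * q / (w * F))"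
      if "w \<noteq> 0" for s x y z w p q F :: complex
      using that by (cases "F = 0") (simp_all add: field_simps)
    from this[OF nz(1)] show ?thesis
      unfolding r1 r2 fn power_Suc .
  qed
  finally show ?case
  proof (rule mult_left_cancel[THEN iffD1, rotated])
    show "4 * (?N + 1) * (?m + a + 2) * (?N + a + 1) * (?m + a + 1) \<noteq> 0"
      using nz by (intro no_zero_divisors) simp_all
  qed
qed

lemma bessel_cross_product_odd:
  assumes "Re a > -1"
  shows "fps_nth (bessel_cross_product a) (2 * n + 1) = 0"
proof -
  have "of_nat (2 * n + 1) + a + 1 \<noteq> 0"
    using assms by (intro Re_gt_imp_nonzero) simp
  then show ?thesis
    using bessel_product_nth_eq_cross_product_nth[of a "2 * n + 1"] bessel_product_odd[OF assms, of n] by (simp del: of_nat_mult of_nat_add)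
qed

lemma bessel_cross_product_even:
  assumes "Re a > -1"
  shows "fps_nth (bessel_cross_product a) (2 * n) =
    2 * (-1) ^ n * rGamma (a + of_nat n + 1) * rGamma (a + of_nat (2 * n) + 2) / fact n"
proof -
  have nz: "of_nat (2 * n) + a + 1 \<noteq> 0"
    using assms by (intro Re_gt_imp_nonzero) simp
  have r: "rGamma (a + of_nat (2 * n) + 1) = (of_nat (2 * n) + a + 1) * rGamma (a + of_nat (2 * n) + 2)"
    using rGamma_shift[of a "2 * n"] by (simp add: add_ac)
  have "(of_nat (2 * n) + a + 1) * fps_nth (bessel_cross_product a) (2 * n) =
     (of_nat (2 * n) + a + 1) *
     (2 * (-1) ^ n * rGamma (a + of_nat n + 1) * rGamma (a + of_nat (2 * n) + 2) / fact n)"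
    unfolding bessel_product_nth_eq_cross_product_nth[symmetric] bessel_product_even[OF assms] r
    by (simp only: mult_ac times_divide_eq_right times_divide_eq_left)
  then show ?thesis using nz by (simp only: mult_cancel_left) simp
qed

section \<open>Univalent, close-to-convex and starlike functions\<close>

text \<open>
  Along the segment from \<open>a\<close> to \<open>b\<close> the real part of \<open>F / (b - a)\<close> has derivative
  \<open>Re F' > 0\<close>, so its values at the end points differ.
\<close>

lemma Noshiro_Warschawski:
  assumes hol: "F holomorphic_on S" and "open S" "convex S"
    and pos: "\<And>z. z \<in> S \<Longrightarrow> Re (deriv F z) > 0"
  shows "inj_on F S"
proof (rule inj_onI, rule ccontr)
  fix a b assume ab: "a \<in> S" "b \<in> S" "F a = F b" "a \<noteq> b"
  define l where "l = (\<lambda>t. a + of_real t * (b - a))"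
  define \<phi> where "\<phi> = (\<lambda>t. Re (F (l t) / (b - a)))"
  have "\<phi> 0 < \<phi> 1"
  proof (rule DERIV_pos_imp_increasing[of 0 1 \<phi>])
    fix t :: real assume t: "0 \<le> t" "t \<le> 1"
    have "l t = (1 - t) *\<^sub>R a + t *\<^sub>R b"
      by (simp add: l_def scaleR_conv_of_real algebra_simps)
    then have lS: "l t \<in> S"
      using \<open>convex S\<close> ab t by (simp add: convex_alt)
    have "(l has_vector_derivative (b - a)) (at t)"
      unfolding l_def by (auto intro!: derivative_eq_intros)
    moreover have "(F has_field_derivative deriv F (l t)) (at (l t))"
      using hol lS \<open>open S\<close> by (auto intro: holomorphic_derivI)
    ultimately have "(F \<circ> l has_vector_derivative (b - a) * deriv F (l t)) (at t)"
      by (rule field_vector_diff_chain_at)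
    then have "((\<lambda>t. F (l t) / (b - a)) has_vector_derivative (b - a) * deriv F (l t) / (b - a)) (at t)"
      by (intro has_vector_derivative_divide) (simp add: o_def)
    from has_field_derivative_Re[OF this] have "(\<phi> has_real_derivative Re (deriv F (l t))) (at t)"
      using ab(4) unfolding \<phi>_def by simp
    then show "\<exists>y. (\<phi> has_real_derivative y) (at t) \<and> 0 < y"
      using pos[OF lS] by blast
  qed simp
  then show False using ab by (simp add: \<phi>_def l_def)
qed

text \<open>
  Kaplan's observation: for a convex comparison function \<open>g\<close>, the function \<open>f \<circ> g\<inverse>\<close> lives on a convex
  domain and has derivative \<open>f'/g'\<close> there, so the Noshiro-Warschawski criterion applies to it.
\<close>

lemma close_to_convex_imp_inj_on:
  assumes "close_to_convex_on_disc f"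
  shows "inj_on f (ball 0 1)"
proof -
  from assms obtain g where g: "g holomorphic_on ball 0 1" "inj_on g (ball 0 1)" "convex (g ` ball 0 1)"
    and pos: "\<And>z. z \<in> ball 0 1 \<Longrightarrow> Re (deriv f z / deriv g z) > 0" and f: "f holomorphic_on ball 0 1"
    unfolding close_to_convex_on_disc_def by blast
  define S where "S = g ` ball 0 1"
  obtain h where h: "h holomorphic_on S" "\<And>z. z \<in> ball 0 1 \<Longrightarrow> deriv g z * deriv h (g z) = 1"
     "\<And>z. z \<in> ball 0 1 \<Longrightarrow> h (g z) = z"
    using holomorphic_has_inverse[OF g(1) open_ball g(2)] unfolding S_def by metis
  have opS: "open S"
    unfolding S_def using g by (intro open_mapping_thm3) auto
  have hS: "h ` S \<subseteq> ball 0 1"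
    using h(3) by (auto simp: S_def)
  have "inj_on (f \<circ> h) S"
  proof (rule Noshiro_Warschawski)
    show "f \<circ> h holomorphic_on S"
      using holomorphic_on_compose_gen[OF h(1) f] hS by blast
    show "convex S" using g by (simp add: S_def)
    fix w assume "w \<in> S"
    then obtain z where z: "z \<in> ball 0 1" "w = g z" by (auto simp: S_def)
    have "deriv (f \<circ> h) w = deriv f (h w) * deriv h w"
    proof (rule deriv_chain)
      show "h field_differentiable at w"
        using h(1) opS \<open>w \<in> S\<close> holomorphic_on_imp_differentiable_at by blast
      show "f field_differentiable at (h w)"
        using f z h(3) holomorphic_on_imp_differentiable_at by (metis open_ball)
    qed
    also have "\<dots> = deriv f z / deriv g z"
    proof -
      have "deriv h w = 1 / deriv g z" 
        using h(2)[OF z(1)] z(2) by (metis mult_zero_left nonzero_mult_div_cancel_left zero_neq_one)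
      then show ?thesis using h(3) z by simp
    qed
    finally show "Re (deriv (f \<circ> h) w) > 0" using pos z by simp
  qed (fact opS)
  show ?thesis
  proof (rule inj_onI)
    fix x y :: complex assume xy: "x \<in> ball 0 1" "y \<in> ball 0 1" "f x = f y"
    then have "(f \<circ> h) (g x) = (f \<circ> h) (g y)" using h(3) by simp
    moreover have "g x \<in> S" "g y \<in> S" using xy by (auto simp: S_def)
    ultimately have "g x = g y" using \<open>inj_on (f \<circ> h) S\<close> by (meson inj_onD)
    then show "x = y" using g(2) xy by (auto dest: inj_onD)
  qed
qed

lemma close_to_convex_of_Re_deriv_pos:
  assumes f: "f holomorphic_on ball 0 1" and "c \<noteq> 0"
    and pos: "\<And>z. z \<in> ball 0 1 \<Longrightarrow> Re (c * deriv f z) > 0"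
  shows "close_to_convex_on_disc f"
  unfolding close_to_convex_on_disc_def
proof (intro conjI exI ballI)
  show "f holomorphic_on ball 0 1" by (fact f)
  show "(\<lambda>z. z / c) holomorphic_on ball 0 1"
    using \<open>c \<noteq> 0\<close> by (intro holomorphic_intros)
  show "inj_on (\<lambda>z. z / c) (ball 0 1)"
    using \<open>c \<noteq> 0\<close> by (auto simp: inj_on_def)
  have "linear (\<lambda>z. z / c)"
    by (rule bounded_linear.linear[OF bounded_linear_divide])
  then show "convex ((\<lambda>z. z / c) ` ball 0 1)"
    by (intro convex_linear_image convex_ball)
  fix z :: complex assume z: "z \<in> ball 0 1"
  have "((\<lambda>z. z / c) has_field_derivative 1 / c) (at z)"
    by (rule DERIV_cdivide) simp
  then have "deriv (\<lambda>z. z / c) z = 1 / c" by (rule DERIV_imp_deriv)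
  then show "Re (deriv f z / deriv (\<lambda>z. z / c) z) > 0"
    using pos[OF z] by (simp add: mult.commute)
qed

text \<open>
  The inverse function \<open>g\<close> makes the proof short. As \<open>t\<close> decreases, \<open>g(t w)\<close> moves with
  \<open>d/dt |g(t w)|\<^sup>2 = 2 |g(t w)|\<^sup>2 Re (f / (\<zeta> f'))(\<zeta>) / t > 0\<close> at \<open>\<zeta> = g(t w)\<close>, that is, towards the
  origin. So the preimage of the ray never leaves the compact disc on which it starts, and the ray
  never leaves the image of this disc.
\<close>

lemma starlike_of_Re_log_deriv_pos:
  assumes f: "f holomorphic_on ball 0 1" "f 0 = 0" "inj_on f (ball 0 1)"
    and pos: "\<And>z. z \<in> ball 0 1 \<Longrightarrow> z \<noteq> 0 \<Longrightarrow> Re (z * deriv f z / f z) > 0"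
  shows "starlike_on_disc f"
  unfolding starlike_on_disc_def
proof (intro conjI ballI f)
  fix w assume "w \<in> f ` ball 0 1"
  then obtain z0 where z0: "z0 \<in> ball 0 1" "w = f z0" by blast
  define r where "r = norm z0"
  have r: "0 \<le> r" "r < 1" using z0 by (auto simp: r_def)
  define S where "S = f ` ball 0 1"
  obtain g where g: "g holomorphic_on S" "\<And>z. z \<in> ball 0 1 \<Longrightarrow> deriv f z * deriv g (f z) = 1"
     "\<And>z. z \<in> ball 0 1 \<Longrightarrow> g (f z) = z"
    using holomorphic_has_inverse[OF f(1) open_ball f(3)] unfolding S_def by metis
  have opS: "open S"
    unfolding S_def using f by (intro open_mapping_thm3) auto
  define K where "K = f ` cball 0 r"
  have rb: "cball 0 r \<subseteq> (ball 0 1 :: complex set)" using r by auto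
  have "compact K" unfolding K_def
    using f(1) rb by (intro compact_continuous_image holomorphic_on_imp_continuous_on)
       (auto intro: holomorphic_on_subset)
  then have clK: "closed K" by (rule compact_imp_closed)
  have KS: "K \<subseteq> S" using rb by (auto simp: K_def S_def)
  have inK: "y \<in> K" if "y \<in> S" "norm (g y) \<le> r" for y
    using that g(3) by (auto simp: K_def S_def)
  have "of_real t * w \<in> K" if t: "0 \<le> t" "t \<le> 1" for t
  proof (rule ccontr)
    assume tK: "of_real t * w \<notin> K"
    \<comment> \<open>\<open>s\<close> is the first place, seen from \<open>w\<close>, at which the ray would leave \<open>K\<close>\<close>
    define U where "U = {s \<in> {0..1}. of_real s * w \<notin> K}"
    define s where "s = Sup U"
    have bdd: "bdd_above U" by (auto simp: U_def intro: bdd_aboveI[of _ 1])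
    have tU: "t \<in> U" using t tK by (simp add: U_def)
    have ts: "t \<le> s" unfolding s_def using tU bdd by (rule cSup_upper)
    have s1: "s \<le> 1" unfolding s_def using tU by (intro cSup_least) (auto simp: U_def)
    have above: "of_real x * w \<in> K" if "s < x" "x \<le> 1" for x
    proof (rule ccontr)
      assume "of_real x * w \<notin> K"
      then have "x \<in> U" using that ts t by (auto simp: U_def)
      then have "x \<le> s" unfolding s_def using bdd by (rule cSup_upper)
      then show False using that by simp
    qed
    have sK: "of_real s * w \<in> K"
    proof (cases "s = 1")
      case True
      then show ?thesis using z0 by (auto simp: K_def r_def)
    next
      case False
      have "((\<lambda>x. of_real x * w) \<longlongrightarrow> of_real s * w) (at_right s)"
        by (intro tendsto_intros)
      moreover have "\<forall>\<^sub>F x in at_right s. of_real x * w \<in> K"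
        using False s1 above unfolding eventually_at_right_field by (intro exI[of _ 1]) auto
      ultimately show ?thesis
        using clK by (intro Lim_in_closed_set) (auto simp: trivial_limit_at_right_real)
    qed
    have "s \<noteq> t" using sK tK by auto
    then have spos: "s > 0" using ts t by simp
    have wnz: "w \<noteq> 0"
      using tK r f(2) by (force simp: K_def)
    obtain \<zeta> where \<zeta>: "norm \<zeta> \<le> r" "of_real s * w = f \<zeta>" using sK by (auto simp: K_def)
    have \<zeta>b: "\<zeta> \<in> ball 0 1" using \<zeta> r by auto
    have \<zeta>nz: "\<zeta> \<noteq> 0" using \<zeta> spos wnz f(2) by auto
    have gs: "g (of_real s * w) = \<zeta>" using \<zeta> \<zeta>b g(3) by simp
    have sS: "of_real s * w \<in> S" using sK KS by auto
    define G where "G = (\<lambda>x::real. g (of_real x * w))"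
    define D where "D = w * deriv g (of_real s * w)"
    have "((\<lambda>x. of_real x * w) has_vector_derivative w) (at s)"
      by (auto intro!: derivative_eq_intros)
    moreover have "(g has_field_derivative deriv g (of_real s * w)) (at (of_real s * w))"
      using g(1) opS sS by (auto intro: holomorphic_derivI)
    ultimately have "(g \<circ> (\<lambda>x. of_real x * w) has_vector_derivative D) (at s)"
      unfolding D_def by (rule field_vector_diff_chain_at)
    then have GD: "(G has_vector_derivative D) (at s)" by (simp add: G_def o_def)
    have dRe: "((\<lambda>x. Re (G x)) has_real_derivative Re D) (at s)"
      using GD by (rule has_field_derivative_Re)
    have dIm: "((\<lambda>x. Im (G x)) has_real_derivative Im D) (at s)"
      using GD by (rule has_field_derivative_Im)
    define N where "N = (\<lambda>x. Re (G x) ^ 2 + Im (G x) ^ 2)"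
    have Gs: "G s = \<zeta>" by (simp add: G_def gs)
    have dN: "(N has_real_derivative 2 * (Re \<zeta> * Re D + Im \<zeta> * Im D)) (at s)"
      unfolding N_def by (rule derivative_eq_intros dRe dIm refl)+ (simp add: Gs algebra_simps)
    have "2 * (Re \<zeta> * Re D + Im \<zeta> * Im D) > 0"
    proof -
      have fnz: "f \<zeta> \<noteq> 0" using \<zeta> spos wnz by (metis mult_eq_0_iff of_real_eq_0_iff less_irrefl)
      define q where "q = \<zeta> * deriv f \<zeta> / f \<zeta>"
      have "Re q > 0" using pos[OF \<zeta>b \<zeta>nz] by (simp add: q_def)
      then have qnz: "q \<noteq> 0" by auto
      have dfnz: "deriv f \<zeta> \<noteq> 0" using qnz by (auto simp: q_def)
      have "D = w / deriv f \<zeta>"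
        using g(2)[OF \<zeta>b] dfnz \<zeta>(2) unfolding D_def by (simp add: field_simps)
      also have "w = f \<zeta> / of_real s" using \<zeta> spos by (simp add: field_simps)
      finally have "D = \<zeta> / q / of_real s"
        using \<zeta>nz dfnz fnz by (simp add: q_def field_simps)
      then have "D * cnj \<zeta> = (\<zeta> * cnj \<zeta>) * inverse q / of_real s"
        by (simp add: divide_inverse mult_ac)
      also have "\<dots> = of_real ((norm \<zeta>)\<^sup>2 / s) * inverse q"
        by (simp add: divide_inverse complex_norm_square[symmetric] mult_ac)
      finally have "D * cnj \<zeta> = of_real ((norm \<zeta>)\<^sup>2 / s) * inverse q" .
      then have "Re (D * cnj \<zeta>) = (norm \<zeta>)\<^sup>2 / s * Re (inverse q)"
        by (simp only: times_complex.simps Re_complex_of_real Im_complex_of_real)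
      moreover have "Re (inverse q) > 0"
        using \<open>Re q > 0\<close> by (simp add: Re_divide zero_less_divide_iff) (metis power2_eq_square sum_power2_gt_zero_iff less_irrefl)
      ultimately have "Re (D * cnj \<zeta>) > 0"
        using spos \<zeta>nz by (metis mult_pos_pos divide_pos_pos zero_less_norm_iff zero_less_power)
      then show ?thesis by (simp add: algebra_simps)
    qed
    from DERIV_pos_inc_left[OF dN this] obtain d where d: "d > 0"
      "\<And>h. 0 < h \<Longrightarrow> h < d \<Longrightarrow> N (s - h) < N s" by blast
    have "continuous (at s) (\<lambda>x. of_real x * w)" by (intro continuous_intros)
    then have "\<forall>\<^sub>F x in at s. of_real x * w \<in> S"
      using opS sS by (auto simp: continuous_at dest: topological_tendstoD)
    then obtain e where e: "e > 0" "\<And>x. x \<noteq> s \<Longrightarrow> dist x s < e \<Longrightarrow> of_real x * w \<in> S"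
      unfolding eventually_at by auto
    have below: "of_real x * w \<in> K" if x: "s - min d e < x" "x \<le> s" for x
    proof (cases "x = s")
      case False
      then have "N x < N s" using d(2)[of "s - x"] x by simp
      also have "N s = (norm \<zeta>)\<^sup>2" by (simp add: N_def Gs cmod_power2)
      finally have "(norm (g (of_real x * w)))\<^sup>2 \<le> (norm \<zeta>)\<^sup>2"
        by (simp add: N_def G_def cmod_power2)
      then have "norm (g (of_real x * w)) \<le> r" using \<zeta>(1) by (simp add: abs_le_square_iff[symmetric])
      moreover have "of_real x * w \<in> S" using e(2)[of x] False x by (auto simp: dist_real_def)
      ultimately show ?thesis by (intro inK)
    qed (use sK in simp)
    have "s - min d e < s" using d e by simp
    then obtain u where u: "u \<in> U" "s - min d e < u"
      unfolding s_def using less_cSup_iff[OF _ bdd] tU by blast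
    have "u \<le> s" unfolding s_def using u(1) bdd by (rule cSup_upper)
    then show False using below[OF u(2)] u(1) by (simp add: U_def)
  qed
  moreover have "closed_segment 0 w = (\<lambda>t. of_real t * w) ` {0..1}"
    by (auto simp: closed_segment_def scaleR_conv_of_real)
  ultimately have "closed_segment 0 w \<subseteq> K" by auto
  then show "closed_segment 0 w \<subseteq> f ` ball 0 1" using KS by (simp add: S_def)
qed

lemma norm_one_minus_power_le:
  fixes z :: complex
  assumes "norm z \<le> 1"
  shows "norm (1 - z ^ n) \<le> real n * norm (1 - z)"
proof (induction n)
  case (Suc n)
  have "1 - z ^ Suc n = (1 - z ^ n) + z ^ n * (1 - z)" by (simp add: algebra_simps)
  then have "norm (1 - z ^ Suc n) \<le> norm (1 - z ^ n) + norm (z ^ n) * norm (1 - z)"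
    using norm_triangle_ineq by (metis norm_mult)
  also have "\<dots> \<le> real n * norm (1 - z) + 1 * norm (1 - z)"
    using assms by (intro add_mono Suc mult_right_mono) (simp_all add: norm_power power_le_one)
  finally show ?case by (simp add: algebra_simps)
qed simp

lemma norm_one_minus_squared_le:
  fixes z :: complex
  assumes "norm z \<le> 1"
  shows "(norm (1 - z))\<^sup>2 \<le> 2 * Re (1 - z)"
proof -
  have "(norm z)\<^sup>2 \<le> 1" using assms by (simp add: power_le_one)
  moreover have "(norm (1 - z))\<^sup>2 = 1 - 2 * Re z + (norm z)\<^sup>2"
    unfolding cmod_power2 by (simp add: power2_eq_square algebra_simps)
  ultimately show ?thesis by simp
qed

text \<open>
  On the circle this is \<open>1 - cos n\<theta> \<le> n\<^sup>2 (1 - cos \<theta>)\<close>. The induction works in the whole disc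
  because the product \<open>(1 - z^n) (1 - z)\<close> is bounded by \<open>n |1 - z|\<^sup>2 \<le> 2 n Re (1 - z)\<close>.
\<close>

lemma Re_one_minus_power_le:
  fixes z :: complex
  assumes "norm z \<le> 1"
  shows "Re (1 - z ^ n) \<le> (real n)\<^sup>2 * Re (1 - z)"
proof (induction n)
  case (Suc n)
  have "1 - z ^ Suc n = (1 - z ^ n) + (1 - z) - (1 - z ^ n) * (1 - z)" by (simp add: algebra_simps)
  then have "Re (1 - z ^ Suc n) = Re (1 - z ^ n) + Re (1 - z) - Re ((1 - z ^ n) * (1 - z))"
    by (simp only: minus_complex.simps plus_complex.simps)
  moreover have "- Re ((1 - z ^ n) * (1 - z)) \<le> norm ((1 - z ^ n) * (1 - z))"
    using abs_Re_le_cmod[of "(1 - z ^ n) * (1 - z)"] by linarith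
  moreover have "norm ((1 - z ^ n) * (1 - z)) \<le> (real n * norm (1 - z)) * norm (1 - z)"
    unfolding norm_mult by (intro mult_right_mono norm_one_minus_power_le assms) auto
  moreover have "(real n * norm (1 - z)) * norm (1 - z) = real n * (norm (1 - z))\<^sup>2" 
    by (simp add: power2_eq_square)
  moreover have "real n * (norm (1 - z))\<^sup>2 \<le> real n * (2 * Re (1 - z))"
    by (intro mult_left_mono norm_one_minus_squared_le assms) auto
  ultimately have "Re (1 - z ^ Suc n) \<le> (real n)\<^sup>2 * Re (1 - z) + Re (1 - z) + real n * (2 * Re (1 - z))"
    using Suc by linarith
  then show ?case by (simp add: power2_eq_square algebra_simps)
qed simp

section \<open>Power series near the boundary point 1\<close>

lemma geometric_tail_sum:
  fixes u :: "nat \<Rightarrow> real"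
  assumes u0: "u 0 = 0" and nonneg: "\<And>n. u n \<ge> 0"
    and q: "0 \<le> q" "q < 1" and ratio: "\<And>n. n \<ge> 1 \<Longrightarrow> u (Suc n) \<le> q * u n"
  shows "summable u" and "suminf u \<le> u 1 / (1 - q)"
proof -
  have le: "u (Suc n) \<le> u 1 * q ^ n" for n
  proof (induction n)
    case (Suc n)
    have "u (Suc (Suc n)) \<le> q * u (Suc n)" by (rule ratio) simp
    also have "\<dots> \<le> q * (u 1 * q ^ n)" by (intro mult_left_mono Suc q)
    finally show ?case by (simp add: mult_ac)
  qed simp
  have geo: "summable (\<lambda>n. u 1 * q ^ n)" using q by (intro summable_mult summable_geometric) simp
  have s: "summable (\<lambda>n. u (Suc n))"
    using le nonneg by (intro summable_comparison_test[OF _ geo] exI[of _ 0]) simp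
  then show su: "summable u" by (simp add: summable_Suc_iff)
  have "suminf u = (\<Sum>n. u (Suc n))" using suminf_split_head[OF su] u0 by simp
  also have "\<dots> \<le> (\<Sum>n. u 1 * q ^ n)" by (rule suminf_le[OF le s geo])
  also have "\<dots> = u 1 / (1 - q)" using q by (simp add: suminf_mult suminf_geometric)
  finally show "suminf u \<le> u 1 / (1 - q)" .
qed

text \<open>
  For a series with real coefficients \<open>b\<^sub>n\<close> and finite \<open>\<Sum> n\<^sup>2 |b\<^sub>n|\<close>, the distance to the value at
  \<open>1\<close> is controlled by \<open>|1 - z|\<close>, and for real parts even by \<open>Re (1 - z)\<close>, which is of second order
  when \<open>z\<close> approaches \<open>1\<close> along the circle. This sharper order is what permits the critical case
  in which the value at \<open>1\<close> vanishes.
\<close>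

context
  fixes b :: "nat \<Rightarrow> real"
  assumes summ: "summable (\<lambda>n. (real n)\<^sup>2 * \<bar>b n\<bar>)"
begin

lemma summable_abs_of_square_weight: "summable (\<lambda>n. \<bar>b n\<bar>)"
proof (rule summable_comparison_test'[OF summ, of 1])
  fix n :: nat assume "n \<ge> 1"
  then have "1 * \<bar>b n\<bar> \<le> (real n)\<^sup>2 * \<bar>b n\<bar>"
    by (intro mult_right_mono) auto
  then show "norm \<bar>b n\<bar> \<le> (real n)\<^sup>2 * \<bar>b n\<bar>" by simp
qed

lemma summable_power_series_of_square_weight:
  fixes z :: complex
  assumes "norm z \<le> 1"
  shows "summable (\<lambda>n. of_real (b n) * z ^ n)"
proof (rule summable_comparison_test'[OF summable_abs_of_square_weight, of 0])
  fix n :: nat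
  have "norm (of_real (b n) * z ^ n) = \<bar>b n\<bar> * norm z ^ n"
    by (simp add: norm_mult norm_power)
  also have "\<dots> \<le> \<bar>b n\<bar> * 1"
    using assms by (intro mult_left_mono power_le_one) auto
  finally show "norm (of_real (b n) * z ^ n) \<le> \<bar>b n\<bar>" by simp
qed

lemma power_series_diff_at_1:
  fixes z :: complex
  assumes z: "norm z \<le> 1"
  shows "(\<lambda>n. of_real (b n) * (z ^ n - 1)) sums ((\<Sum>n. of_real (b n) * z ^ n) - of_real (\<Sum>n. b n))"
proof -
  have "(\<lambda>n. complex_of_real (b n)) sums of_real (\<Sum>n. b n)"
    by (intro sums_of_real summable_sums summable_rabs_cancel[OF summable_abs_of_square_weight])
  from sums_diff[OF summable_sums[OF summable_power_series_of_square_weight[OF z]] this]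
  show ?thesis by (simp add: algebra_simps)
qed

lemma norm_power_series_diff_at_1_le:
  fixes z :: complex
  assumes z: "norm z \<le> 1"
  shows "norm ((\<Sum>n. of_real (b n) * z ^ n) - of_real (\<Sum>n. b n))
    \<le> norm (1 - z) * (\<Sum>n. (real n)\<^sup>2 * \<bar>b n\<bar>)"
proof -
  have le: "norm (of_real (b n) * (z ^ n - 1)) \<le> norm (1 - z) * ((real n)\<^sup>2 * \<bar>b n\<bar>)" for n
  proof -
    have "norm (of_real (b n) * (z ^ n - 1)) = \<bar>b n\<bar> * norm (1 - z ^ n)"
      by (simp add: norm_mult norm_minus_commute)
    also have "\<dots> \<le> \<bar>b n\<bar> * (real n * norm (1 - z))"
      by (intro mult_left_mono norm_one_minus_power_le z) auto
    also have "\<dots> \<le> \<bar>b n\<bar> * ((real n)\<^sup>2 * norm (1 - z))"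
      by (intro mult_left_mono mult_right_mono) (auto simp: power2_eq_square simp flip: of_nat_mult)
    finally show ?thesis by (simp add: mult_ac)
  qed
  have s: "summable (\<lambda>n. norm (1 - z) * ((real n)\<^sup>2 * \<bar>b n\<bar>))"
    using summ by (rule summable_mult)
  have "norm (\<Sum>n. of_real (b n) * (z ^ n - 1)) \<le> (\<Sum>n. norm (1 - z) * ((real n)\<^sup>2 * \<bar>b n\<bar>))"
    by (rule norm_suminf_le[OF le s])
  then show ?thesis
    using sums_unique[OF power_series_diff_at_1[OF z]] summ by (simp add: suminf_mult)
qed

text \<open>
  In the second part a negative linear term is moved to the favourable side: \<open>b\<^sub>1 (z - 1)\<close> contributes
  exactly \<open>|b\<^sub>1| Re (1 - z)\<close>, and the factor \<open>2\<close> compensates for its presence in the sum.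
\<close>

lemma Re_power_series_diff_at_1:
  fixes z :: complex
  assumes z: "norm z \<le> 1"
  shows "\<bar>Re (\<Sum>n. of_real (b n) * z ^ n) - (\<Sum>n. b n)\<bar> \<le> Re (1 - z) * (\<Sum>n. (real n)\<^sup>2 * \<bar>b n\<bar>)"
    and "b 1 \<le> 0 \<Longrightarrow>
      Re (1 - z) * (2 * \<bar>b 1\<bar> - (\<Sum>n. (real n)\<^sup>2 * \<bar>b n\<bar>)) \<le> Re (\<Sum>n. of_real (b n) * z ^ n) - (\<Sum>n. b n)"
proof -
  define d where "d = Re (1 - z)"
  have zn: "Re (1 - z ^ n) \<ge> 0" for n
  proof -
    have "Re (z ^ n) \<le> norm (z ^ n)" by (rule complex_Re_le_cmod)
    also have "\<dots> \<le> 1" using z by (simp add: norm_power power_le_one)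
    finally show ?thesis by simp
  qed
  have "\<bar>b n\<bar> * Re (1 - z ^ n) \<le> \<bar>b n\<bar> * ((real n)\<^sup>2 * d)" for n
    unfolding d_def by (intro mult_left_mono Re_one_minus_power_le z) auto
  then have le: "\<bar>b n * Re (z ^ n - 1)\<bar> \<le> d * ((real n)\<^sup>2 * \<bar>b n\<bar>)" for n
    using zn[of n] by (simp add: abs_mult mult_ac abs_minus_commute)
  have S: "(\<lambda>n. b n * Re (z ^ n - 1)) sums (Re (\<Sum>n. of_real (b n) * z ^ n) - (\<Sum>n. b n))"
    using sums_Re[OF power_series_diff_at_1[OF z]] by simp
  have T: "(\<lambda>n. d * ((real n)\<^sup>2 * \<bar>b n\<bar>)) sums (d * (\<Sum>n. (real n)\<^sup>2 * \<bar>b n\<bar>))"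
    by (intro sums_mult summable_sums summ)
  have U: "(\<lambda>n. if n = 1 then 2 * d * \<bar>b n\<bar> else 0) sums (2 * d * \<bar>b 1\<bar>)"
    by (rule sums_single)
  have "Re (\<Sum>n. of_real (b n) * z ^ n) - (\<Sum>n. b n) \<le> d * (\<Sum>n. (real n)\<^sup>2 * \<bar>b n\<bar>)"
    using le by (intro sums_le[OF _ S T]) (simp add: abs_le_iff)
  moreover have "- (d * (\<Sum>n. (real n)\<^sup>2 * \<bar>b n\<bar>)) \<le> Re (\<Sum>n. of_real (b n) * z ^ n) - (\<Sum>n. b n)"
    using le by (intro sums_le[OF _ sums_minus[OF T] S]) (simp add: abs_le_iff minus_le_iff)
  ultimately show "\<bar>Re (\<Sum>n. of_real (b n) * z ^ n) - (\<Sum>n. b n)\<bar>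
      \<le> Re (1 - z) * (\<Sum>n. (real n)\<^sup>2 * \<bar>b n\<bar>)"
    unfolding d_def[symmetric] by linarith
  assume b1: "b 1 \<le> 0"
  have "2 * d * \<bar>b 1\<bar> - d * (\<Sum>n. (real n)\<^sup>2 * \<bar>b n\<bar>) \<le> Re (\<Sum>n. of_real (b n) * z ^ n) - (\<Sum>n. b n)"
  proof (rule sums_le[OF _ sums_diff[OF U T] S])
    fix n
    show "(if n = 1 then 2 * d * \<bar>b n\<bar> else 0) - d * ((real n)\<^sup>2 * \<bar>b n\<bar>) \<le> b n * Re (z ^ n - 1)"
    proof (cases "n = 1")
      case True
      then show ?thesis using b1 by (simp add: d_def algebra_simps)
    next
      case False
      then show ?thesis using le[of n] by (simp add: abs_le_iff)
    qed
  qed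
  then show "Re (1 - z) * (2 * \<bar>b 1\<bar> - (\<Sum>n. (real n)\<^sup>2 * \<bar>b n\<bar>))
      \<le> Re (\<Sum>n. of_real (b n) * z ^ n) - (\<Sum>n. b n)"
    unfolding d_def by (simp add: algebra_simps)
qed

end

lemma fps_nth_funpow_deriv: "fps_nth ((fps_deriv ^^ k) F) n = fact (n + k) / fact n * fps_nth F (n + k)"
  for F :: "complex fps"
proof (induction k arbitrary: n)
  case (Suc k)
  have "(1 :: complex) + of_nat n \<noteq> 0" by (metis of_nat_Suc of_nat_neq_0)
  then have "y * (p / (y * q) * x) = p / q * x" if "y = 1 + of_nat n" for p q x y :: complex
    using that by simp
  moreover have "fact (Suc n) = (1 + of_nat n) * (fact n :: complex)" by simp
  ultimately show ?case by (simp add: Suc add_ac del: fact_Suc)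
qed simp

lemma fps_conv_radius_funpow_deriv:
  "fps_conv_radius F = \<infinity> \<Longrightarrow> fps_conv_radius ((fps_deriv ^^ k) F) = \<infinity>" for F :: "complex fps"
proof (induction k)
  case (Suc k)
  then show ?case using fps_conv_radius_deriv[of "(fps_deriv ^^ k) F"] by simp
qed simp

lemma funpow_deriv_eval_fps:
  "fps_conv_radius F = \<infinity> \<Longrightarrow> (deriv ^^ k) (eval_fps F) = eval_fps ((fps_deriv ^^ k) F)" for F :: "complex fps"
proof (induction k)
  case (Suc k)
  have "deriv (eval_fps ((fps_deriv ^^ k) F)) = eval_fps (fps_deriv ((fps_deriv ^^ k) F))"
    using Suc.prems by (intro ext eval_fps_deriv[symmetric]) (simp add: fps_conv_radius_funpow_deriv)
  then show ?case using Suc by simp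
qed simp

section \<open>Alternating series with rapidly decreasing coefficients\<close>

text \<open>
  The coefficients of \<open>f(z) = \<Sum> (-1)^n c\<^sub>n z^(n+1)\<close>. The first step from \<open>c\<^sub>0\<close> to \<open>c\<^sub>1\<close> is left
  open, since \<open>c\<^sub>1\<close> is unbounded as \<open>\<nu>\<close> tends to \<open>-1\<close>; it decides about starlikeness. The factor
  \<open>n\<close> in the decay makes \<open>f\<close> entire, and the value \<open>384\<close> is \<open>16 * 2 * 3 * 4\<close>, the limit at
  \<open>\<nu> = -1\<close> of \<open>c\<^sub>1 / c\<^sub>2\<close>.
\<close>

locale rapid_alternating_series =
  fixes c :: "nat \<Rightarrow> real"
  assumes c_0: "c 0 = 1" and c_pos: "c n > 0"
    and decay: "n \<ge> 1 \<Longrightarrow> 384 * real n * c (Suc n) \<le> c n"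
begin

text \<open>
  The decay by \<open>384\<close> absorbs any weight growing by at most \<open>64\<close>; the common ratio \<open>1/6\<close> suffices for
  all weighted sums below.
\<close>

lemma decay_weighted:
  assumes "n \<ge> 1" "v \<ge> 0" "w \<le> 64 * v"
  shows "w * c (Suc n) \<le> 1/6 * (v * c n)"
proof -
  have "384 * 1 * c (Suc n) \<le> 384 * real n * c (Suc n)"
    using assms(1) c_pos[of "Suc n"] by (intro mult_right_mono mult_left_mono) auto
  then have 1: "384 * c (Suc n) \<le> c n" using decay[OF assms(1)] by simp
  have "w * c (Suc n) \<le> 64 * v * c (Suc n)"
    using assms c_pos[of "Suc n"] by (intro mult_right_mono) auto
  also have "\<dots> = 1/6 * (v * (384 * c (Suc n)))" by simp
  also have "\<dots> \<le> 1/6 * (v * c n)" by (intro mult_left_mono 1 assms) auto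
  finally show ?thesis .
qed

lemma weight_bound: "(real n + 2) * (real n + 1) \<le> 6 * (real n)\<^sup>2" if "n \<ge> 1" for n
proof -
  have "real n \<ge> 1" using that by simp
  then have "1 * real n \<le> real n * real n" by (intro mult_right_mono) auto
  moreover have "(real n + 2) * (real n + 1) = real n * real n + 3 * real n + 2"
    by (simp add: algebra_simps)
  ultimately show ?thesis using \<open>real n \<ge> 1\<close> unfolding power2_eq_square by linarith
qed

text \<open>
  The letters \<open>h\<close> and \<open>k\<close> stand for \<open>f(z)/z\<close> and \<open>-(f(z)/z)'\<close>. This bound and the next two
  say that the linear coefficients of \<open>h\<close> and \<open>f'\<close> and the constant coefficient of \<open>k\<close> dominate the \<open>n\<^sup>2\<close>-weighted rest of the respective series.
\<close>

lemma
  shows summable_h: "summable (\<lambda>n. (real n)\<^sup>2 * c n)"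
    and suminf_h: "(\<Sum>n. (real n)\<^sup>2 * c n) \<le> 6/5 * c 1"
proof -
  have r: "(real (Suc n))\<^sup>2 * c (Suc n) \<le> 1/6 * ((real n)\<^sup>2 * c n)" if "n \<ge> 1" for n
  proof (rule decay_weighted[OF that])
    have "(real (Suc n))\<^sup>2 \<le> (real n + 2) * (real n + 1)" by (simp add: power2_eq_square algebra_simps)
    then show "(real (Suc n))\<^sup>2 \<le> 64 * (real n)\<^sup>2" using weight_bound[OF that] zero_le_power2[of "real n"] by linarith
  qed simp
  note g = geometric_tail_sum[of "\<lambda>n. (real n)\<^sup>2 * c n" "1/6", OF _ _ _ _ r]
  show "summable (\<lambda>n. (real n)\<^sup>2 * c n)" using g(1) c_pos by (simp add: less_imp_le)
  show "(\<Sum>n. (real n)\<^sup>2 * c n) \<le> 6/5 * c 1" using g(2) c_pos by (simp add: less_imp_le)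
qed

lemma
  shows summable_f': "summable (\<lambda>n. (real n)\<^sup>2 * (real (Suc n) * c n))"
    and suminf_f': "(\<Sum>n. (real n)\<^sup>2 * (real (Suc n) * c n)) \<le> 12/5 * c 1"
proof -
  have r: "(real (Suc n))\<^sup>2 * (real (Suc (Suc n)) * c (Suc n)) \<le> 1/6 * ((real n)\<^sup>2 * (real (Suc n) * c n))" if "n \<ge> 1" for n
  proof -
    have "((real (Suc n))\<^sup>2 * real (Suc (Suc n))) * c (Suc n) \<le> 1/6 * (((real n)\<^sup>2 * real (Suc n)) * c n)"
    proof (rule decay_weighted[OF that])
      have "(real (Suc n))\<^sup>2 * real (Suc (Suc n)) = real (Suc n) * ((real n + 2) * (real n + 1))"
        by (simp add: power2_eq_square algebra_simps)
      also have "\<dots> \<le> real (Suc n) * (6 * (real n)\<^sup>2)"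
        using weight_bound[OF that] by (intro mult_left_mono) auto
      also have "\<dots> \<le> real (Suc n) * (64 * (real n)\<^sup>2)" by (intro mult_left_mono) auto
      finally show "(real (Suc n))\<^sup>2 * real (Suc (Suc n)) \<le> 64 * ((real n)\<^sup>2 * real (Suc n))"
        by (simp only: mult_ac)
    qed simp
    then show ?thesis by (simp only: mult_ac)
  qed
  note g = geometric_tail_sum[of "\<lambda>n. (real n)\<^sup>2 * (real (Suc n) * c n)" "1/6", OF _ _ _ _ r]
  show "summable (\<lambda>n. (real n)\<^sup>2 * (real (Suc n) * c n))" using g(1) c_pos by (simp add: less_imp_le)
  show "(\<Sum>n. (real n)\<^sup>2 * (real (Suc n) * c n)) \<le> 12/5 * c 1" using g(2) c_pos by (simp add: less_imp_le)
qed

lemma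
  shows summable_k: "summable (\<lambda>n. (real n)\<^sup>2 * (real (Suc n) * c (Suc n)))"
    and suminf_k: "(\<Sum>n. (real n)\<^sup>2 * (real (Suc n) * c (Suc n))) \<le> 1/100 * c 1"
proof -
  have r: "(real (Suc n))\<^sup>2 * (real (Suc (Suc n)) * c (Suc (Suc n))) \<le> 1/6 * ((real n)\<^sup>2 * (real (Suc n) * c (Suc n)))" if "n \<ge> 1" for n
  proof -
    have "((real (Suc n))\<^sup>2 * real (Suc (Suc n))) * c (Suc (Suc n)) \<le> 1/6 * (((real n)\<^sup>2 * real (Suc n)) * c (Suc n))"
    proof (rule decay_weighted)
      have "(real (Suc n))\<^sup>2 * real (Suc (Suc n)) = real (Suc n) * ((real n + 2) * (real n + 1))"
        by (simp add: power2_eq_square algebra_simps)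
      also have "\<dots> \<le> real (Suc n) * (6 * (real n)\<^sup>2)"
        using weight_bound[OF that] by (intro mult_left_mono) auto
      also have "\<dots> \<le> real (Suc n) * (64 * (real n)\<^sup>2)" by (intro mult_left_mono) auto
      finally show "(real (Suc n))\<^sup>2 * real (Suc (Suc n)) \<le> 64 * ((real n)\<^sup>2 * real (Suc n))"
        by (simp only: mult_ac)
    qed simp_all
    then show ?thesis by (simp only: mult_ac)
  qed
  note g = geometric_tail_sum[of "\<lambda>n. (real n)\<^sup>2 * (real (Suc n) * c (Suc n))" "1/6", OF _ _ _ _ r]
  show "summable (\<lambda>n. (real n)\<^sup>2 * (real (Suc n) * c (Suc n)))" using g(1) c_pos by (simp add: less_imp_le)
  have "(\<Sum>n. (real n)\<^sup>2 * (real (Suc n) * c (Suc n))) \<le> 12/5 * c 2" 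
    using g(2) c_pos by (simp add: less_imp_le numeral_2_eq_2)
  also have "\<dots> \<le> 1/100 * c 1" using decay[of 1] c_pos[of 2] by (simp add: numeral_2_eq_2)
  finally show "(\<Sum>n. (real n)\<^sup>2 * (real (Suc n) * c (Suc n))) \<le> 1/100 * c 1" .
qed

definition series :: "complex fps" where
  "series = Abs_fps (\<lambda>n. of_real (case n of 0 \<Rightarrow> 0 | Suc m \<Rightarrow> (-1) ^ m * c m))"

lemma fps_conv_radius_series: "fps_conv_radius series = \<infinity>"
proof -
  have "filterlim (\<lambda>n. norm (fps_nth series n) / norm (fps_nth series (Suc n))) at_top sequentially"
  proof (rule filterlim_at_top_mono)
    show "filterlim (\<lambda>n. -1 + real n) at_top sequentially"
      by (rule filterlim_tendsto_add_at_top[OF tendsto_const filterlim_real_sequentially])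
    have "real n - 1 \<le> norm (fps_nth series n) / norm (fps_nth series (Suc n))" if n: "n \<ge> 2" for n
    proof -
      obtain m where m: "n = Suc m" "m \<ge> 1"
        using n that[of "n - 1"] by auto
      have "real m * c (Suc m) \<le> 384 * real m * c (Suc m)"
        using c_pos[of "Suc m"] by (intro mult_right_mono) auto
      also have "\<dots> \<le> c m" by (rule decay[OF m(2)])
      finally have "real m \<le> c m / c (Suc m)" using c_pos[of "Suc m"] by (simp add: field_simps)
      then show ?thesis using c_pos by (simp add: series_def m norm_mult norm_power abs_of_pos)
    qed
    then show "\<forall>\<^sub>F n in sequentially. -1 + real n \<le> norm (fps_nth series n) / norm (fps_nth series (Suc n))"
      unfolding eventually_sequentially by (intro exI[of _ 2]) auto
  qed
  then show ?thesis unfolding fps_conv_radius_def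
    by (intro conv_radius_ratio_limit_ereal_nonzero) (auto simp: tendsto_PInfty_eq_at_top)
qed

text \<open>
  For \<open>k \<ge> 1\<close> the step from \<open>c\<^sub>0\<close> to \<open>c\<^sub>1\<close> no longer enters \<open>f^(k+1)\<close>, whose coefficients thus
  decrease geometrically from the start: its constant term exceeds the sum of the others.
\<close>

lemma close_to_convex_funpow_deriv:
  assumes "k \<ge> 1"
  shows "close_to_convex_on_disc ((deriv ^^ k) (eval_fps series))"
proof -
  define b where "b = (\<lambda>n. fact (n + Suc k) / fact n * c (n + k))"
  \<comment> \<open>the sign of the constant term of \<open>f^(k+1)\<close>\<close>
  define e where "e = (-1 :: complex) ^ k"
  have bpos: "b n > 0" for n using c_pos by (simp add: b_def)
  have ratio: "b (Suc n) \<le> 1/6 * b n" for n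
  proof -
    have nk: "real (n + k) \<ge> 1" using assms by simp
    have "(real (n + k) + 2) * c (Suc (n + k)) \<le> (3 * real (n + k)) * c (Suc (n + k))"
      using nk c_pos[of "Suc (n + k)"] by (intro mult_right_mono) auto
    also have "\<dots> \<le> 1 / 128 * c (n + k)" using decay[of "n + k"] assms by (simp add: algebra_simps)
    also have "\<dots> \<le> 1 / 6 * c (n + k)" using c_pos[of "n + k"] by simp
    finally have 1: "(real (n + k) + 2) * c (Suc (n + k)) \<le> 1 / 6 * c (n + k)" .
    have "b (Suc n) = fact (n + Suc k) / fact n * ((real (n + k) + 2) * c (Suc (n + k))) / (real n + 1)"
      by (simp add: b_def field_simps)
    also have "\<dots> \<le> fact (n + Suc k) / fact n * ((real (n + k) + 2) * c (Suc (n + k))) / 1"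
      using c_pos[of "Suc (n + k)"] by (intro divide_left_mono) auto
    also have "\<dots> \<le> fact (n + Suc k) / fact n * (1 / 6 * c (n + k))"
      unfolding div_by_1 by (intro mult_left_mono 1) auto
    finally show ?thesis by (simp add: b_def)
  qed
  define u where "u = (\<lambda>n. if n = 0 then 0 else b n)"
  have u: "summable u" "suminf u \<le> u 1 / (1 - 1/6)"
    by (rule geometric_tail_sum[of u "1/6"]; use ratio bpos in \<open>simp add: u_def less_imp_le\<close>)+
  have coeff: "fps_nth ((fps_deriv ^^ Suc k) series) n = e * of_real ((-1) ^ n * b n)" for n
    unfolding fps_nth_funpow_deriv by (simp add: series_def b_def e_def power_add)
  have Re_pos: "Re (e * deriv ((deriv ^^ k) (eval_fps series)) z) > 0" if z: "z \<in> ball 0 1" for z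
  proof -
    have ee: "e * e = 1" by (simp add: e_def flip: power_mult_distrib)
    have "deriv ((deriv ^^ k) (eval_fps series)) z = eval_fps ((fps_deriv ^^ Suc k) series) z"
      using funpow_deriv_eval_fps[OF fps_conv_radius_series, of "Suc k"] by simp
    moreover have "(\<lambda>n. fps_nth ((fps_deriv ^^ Suc k) series) n * z ^ n) sums eval_fps ((fps_deriv ^^ Suc k) series) z"
      by (rule sums_eval_fps) (simp only: fps_conv_radius_funpow_deriv[OF fps_conv_radius_series], simp)
    ultimately have "(\<lambda>n. e * (fps_nth ((fps_deriv ^^ Suc k) series) n * z ^ n)) sums (e * deriv ((deriv ^^ k) (eval_fps series)) z)"
      by (intro sums_mult) simp
    moreover have "e * (e * x * y) = x * y" for x y using ee by (metis mult.assoc mult_1)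
    ultimately have S: "(\<lambda>n. of_real ((-1) ^ n * b n) * z ^ n) sums (e * deriv ((deriv ^^ k) (eval_fps series)) z)"
      unfolding coeff by simp
    have T: "(\<lambda>n. (if n = 0 then b n else 0) - u n) sums (b 0 - suminf u)"
      by (intro sums_diff summable_sums u sums_single)
    have "b 0 - suminf u \<le> Re (e * deriv ((deriv ^^ k) (eval_fps series)) z)"
    proof (rule sums_le[OF _ T sums_Re[OF S]])
      fix n
      have "norm (of_real ((-1) ^ n * b n) * z ^ n) = b n * norm z ^ n"
        using bpos[of n] by (simp add: norm_mult norm_power)
      also have "\<dots> \<le> b n * 1"
        using z bpos[of n] by (intro mult_left_mono power_le_one) (auto simp: less_imp_le)
      finally have "\<bar>Re (of_real ((-1) ^ n * b n) * z ^ n)\<bar> \<le> b n"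
        using abs_Re_le_cmod[of "of_real ((-1) ^ n * b n) * z ^ n"] by linarith
      then show "(if n = 0 then b n else 0) - u n \<le> Re (of_real ((-1) ^ n * b n) * z ^ n)"
        by (cases "n = 0") (auto simp: u_def abs_le_iff)
    qed
    moreover have "suminf u < b 0" using u(2) ratio[of 0] bpos[of 0] by (simp add: u_def)
    ultimately show ?thesis by linarith
  qed
  show ?thesis
  proof (rule close_to_convex_of_Re_deriv_pos)
    show "(deriv ^^ k) (eval_fps series) holomorphic_on ball 0 1"
      unfolding funpow_deriv_eval_fps[OF fps_conv_radius_series]
      by (intro holomorphic_on_eval_fps) (simp add: fps_conv_radius_funpow_deriv[OF fps_conv_radius_series])
    show "e \<noteq> 0" by (simp add: e_def)
  qed (rule Re_pos)
qed

text \<open>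
  The quotient \<open>f(z)/z\<close>, continued to the origin.
\<close>

definition unit_factor :: "complex \<Rightarrow> complex" where
  "unit_factor z = (\<Sum>n. of_real ((-1) ^ n * c n) * z ^ n)"

lemma eval_series: "eval_fps series z = z * unit_factor z"
proof -
  have "(\<lambda>n. fps_nth series n * z ^ n) sums eval_fps series z"
    by (rule sums_eval_fps) (simp add: fps_conv_radius_series)
  then have "(\<lambda>n. fps_nth series (Suc n) * z ^ Suc n) sums eval_fps series z"
    using sums_Suc_iff[of "\<lambda>n. fps_nth series n * z ^ n" "eval_fps series z"]
    by (simp add: series_def)
  then have *: "(\<lambda>n. z * (of_real ((-1) ^ n * c n) * z ^ n)) sums eval_fps series z"
    by (simp add: series_def mult_ac)
  show ?thesis
  proof (cases "z = 0")
    case False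
    then have "(\<lambda>n. of_real ((-1) ^ n * c n) * z ^ n) sums (eval_fps series z / z)"
      using sums_divide[OF *, of z] by simp
    then show ?thesis using False by (simp add: unit_factor_def sums_iff)
  qed (use * in \<open>simp add: sums_iff\<close>)
qed

definition deriv_coeff :: "nat \<Rightarrow> real" where
  "deriv_coeff n = (-1) ^ n * (real (Suc n) * c n)"

lemma abs_deriv_coeff: "\<bar>deriv_coeff n\<bar> = real (Suc n) * c n"
  using c_pos[of n] by (simp add: deriv_coeff_def abs_mult)

lemma summable_deriv_coeff: "summable (\<lambda>n. (real n)\<^sup>2 * \<bar>deriv_coeff n\<bar>)"
  using summable_f' by (simp only: abs_deriv_coeff)

lemma deriv_eval_series: "deriv (eval_fps series) z = (\<Sum>n. of_real (deriv_coeff n) * z ^ n)"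
proof -
  have "deriv (eval_fps series) z = eval_fps (fps_deriv series) z"
    by (rule eval_fps_deriv[symmetric]) (simp add: fps_conv_radius_series)
  then show ?thesis by (simp add: eval_fps_def series_def deriv_coeff_def mult_ac)
qed

definition deriv_at_1 :: real where
  "deriv_at_1 = (\<Sum>n. deriv_coeff n)"

lemma deriv_at_1: "deriv (eval_fps series) 1 = of_real deriv_at_1"
  using suminf_of_real[OF summable_rabs_cancel[OF summable_abs_of_square_weight[OF summable_deriv_coeff]],
    where ?'a = complex]
  unfolding deriv_eval_series deriv_at_1_def by simp

lemma deriv_at_0: "deriv (eval_fps series) 0 = 1"
proof -
  have "deriv (eval_fps series) 0 = eval_fps (fps_deriv series) 0"
    by (rule eval_fps_deriv[symmetric]) (simp add: fps_conv_radius_series)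
  then show ?thesis by (simp add: eval_fps_at_0 series_def c_0)
qed

text \<open>
  Here \<open>8/5 = 4 - 12/5\<close>, since the linear coefficient \<open>-2 c\<^sub>1\<close> of \<open>f'\<close> enters the lower bound twice.
\<close>

lemma Re_deriv_ge:
  assumes z: "norm z \<le> 1"
  shows "Re (deriv (eval_fps series) z) \<ge> deriv_at_1 + 8/5 * c 1 * Re (1 - z)"
proof -
  have "deriv_coeff 1 \<le> 0" using c_pos[of 1] by (simp add: deriv_coeff_def)
  then have "Re (1 - z) * (2 * \<bar>deriv_coeff 1\<bar> - (\<Sum>n. (real n)\<^sup>2 * \<bar>deriv_coeff n\<bar>))
      \<le> Re (deriv (eval_fps series) z) - deriv_at_1"
    unfolding deriv_eval_series deriv_at_1_def
    by (rule Re_power_series_diff_at_1(2)[OF summable_deriv_coeff z])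
  moreover have "Re (1 - z) * (8/5 * c 1) \<le>
      Re (1 - z) * (2 * \<bar>deriv_coeff 1\<bar> - (\<Sum>n. (real n)\<^sup>2 * \<bar>deriv_coeff n\<bar>))"
    using suminf_f' z complex_Re_le_cmod[of z] unfolding abs_deriv_coeff by (intro mult_left_mono) auto
  ultimately show ?thesis by (simp only: mult.commute)
qed

lemma inj_on_eval_series:
  assumes "deriv_at_1 \<ge> 0"
  shows "inj_on (eval_fps series) (ball 0 1)"
proof (rule Noshiro_Warschawski)
  show "eval_fps series holomorphic_on ball 0 1"
    by (intro holomorphic_on_eval_fps) (simp add: fps_conv_radius_series)
  fix z :: complex assume "z \<in> ball 0 1"
  then have z: "norm z < 1" by simp
  then have "Re (1 - z) > 0" using complex_Re_le_cmod[of z] by simp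
  then have "8/5 * c 1 * Re (1 - z) > 0" using c_pos[of 1] by simp
  then show "Re (deriv (eval_fps series) z) > 0"
    using Re_deriv_ge[of z] z assms by linarith
qed auto

text \<open>
  \<open>f'\<close> is real on the real axis and changes sign between \<open>0\<close> and \<open>1\<close>, whereas an injective
  holomorphic function has no critical point.
\<close>

lemma not_inj_on_eval_series:
  assumes "deriv_at_1 < 0"
  shows "\<not> inj_on (eval_fps series) (ball 0 1)"
proof
  assume inj: "inj_on (eval_fps series) (ball 0 1)"
  have hol: "eval_fps series holomorphic_on UNIV"
    by (intro holomorphic_on_eval_fps) (simp add: fps_conv_radius_series)
  define \<phi> where "\<phi> = (\<lambda>x::real. Re (deriv (eval_fps series) (of_real x)))"
  have "continuous_on UNIV (deriv (eval_fps series))"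
    using hol by (intro holomorphic_on_imp_continuous_on holomorphic_deriv) auto
  then have "continuous_on {0..1} (\<lambda>x::real. deriv (eval_fps series) (of_real x))"
    by (rule continuous_on_compose2) (auto intro: continuous_on_of_real continuous_on_id)
  then have "continuous_on {0..1} \<phi>"
    unfolding \<phi>_def by (rule continuous_on_Re)
  moreover have "\<phi> 0 = 1" "\<phi> 1 < 0" using assms by (simp_all add: \<phi>_def deriv_at_0 deriv_at_1)
  ultimately obtain x where x: "0 \<le> x" "x \<le> 1" "\<phi> x = 0"
    using IVT2'[of \<phi> 1 0 0] by auto
  with \<open>\<phi> 1 < 0\<close> have "x \<noteq> 1" by auto
  have "summable (\<lambda>n. of_real (deriv_coeff n) * complex_of_real x ^ n)"
    by (rule summable_power_series_of_square_weight[OF summable_deriv_coeff]) (use x in simp)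
  from sums_Im[OF summable_sums[OF this]]
  have "(\<lambda>n. 0) sums Im (deriv (eval_fps series) (of_real x))"
    by (simp add: deriv_eval_series flip: of_real_power)
  then have "Im (deriv (eval_fps series) (of_real x)) = 0" by (simp add: sums_iff)
  with x have "deriv (eval_fps series) (of_real x) = 0" by (simp add: \<phi>_def complex_eq_iff)
  moreover have "complex_of_real x \<in> ball 0 1" using x \<open>x \<noteq> 1\<close> by simp
  ultimately show False
    using holomorphic_injective_imp_regular[OF holomorphic_on_subset[OF hol] open_ball inj] by simp
qed

text \<open>
  The function \<open>-(f(z)/z)'\<close>, so that \<open>z f'(z) / f(z) = 1 - z k(z) / h(z)\<close> for this function \<open>k\<close> and
  \<open>h(z) = f(z)/z\<close>.
\<close>

definition log_deriv_numerator :: "complex \<Rightarrow> complex" where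
  "log_deriv_numerator z = (\<Sum>n. of_real ((-1) ^ n * (real (Suc n) * c (Suc n))) * z ^ n)"

lemma abs_sign: "\<bar>(-1) ^ n * c m\<bar> = c m" "\<bar>(-1) ^ n * (real (Suc k) * c m)\<bar> = real (Suc k) * c m"
  using c_pos[of m] by (simp_all add: abs_mult)

lemma
  shows summable_h_coeff: "summable (\<lambda>n. (real n)\<^sup>2 * \<bar>(-1) ^ n * c n\<bar>)"
    and summable_k_coeff: "summable (\<lambda>n. (real n)\<^sup>2 * \<bar>(-1) ^ n * (real (Suc n) * c (Suc n))\<bar>)"
  using summable_h summable_k by (simp_all only: abs_sign)

lemma deriv_eval_series_decomp:
  assumes z: "norm z \<le> 1"
  shows "deriv (eval_fps series) z = unit_factor z - z * log_deriv_numerator z"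
proof -
  have "(\<lambda>n. of_real ((-1) ^ n * c n) * z ^ n) sums unit_factor z"
    unfolding unit_factor_def
    by (rule summable_sums[OF summable_power_series_of_square_weight[OF summable_h_coeff z]])
  moreover have "(\<lambda>n. of_real ((-1) ^ n * (real (Suc n) * c (Suc n))) * z ^ n) sums log_deriv_numerator z"
    unfolding log_deriv_numerator_def
    by (rule summable_sums[OF summable_power_series_of_square_weight[OF summable_k_coeff z]])
  then have "(\<lambda>n. - z * (of_real ((-1) ^ n * (real (Suc n) * c (Suc n))) * z ^ n)) sums (- z * log_deriv_numerator z)"
    by (rule sums_mult)
  then have "(\<lambda>n. (\<lambda>m. of_real ((-1) ^ m * (real m * c m)) * z ^ m) (Suc n)) sums (- z * log_deriv_numerator z)"
    by (simp add: mult_ac)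
  then have "(\<lambda>m. of_real ((-1) ^ m * (real m * c m)) * z ^ m) sums (- z * log_deriv_numerator z)"
    by (subst (asm) sums_Suc_iff) simp
  ultimately have "(\<lambda>n. of_real ((-1) ^ n * c n) * z ^ n + of_real ((-1) ^ n * (real n * c n)) * z ^ n)
      sums (unit_factor z + - z * log_deriv_numerator z)"
    by (rule sums_add)
  moreover have "of_real ((-1) ^ n * c n) * z ^ n + of_real ((-1) ^ n * (real n * c n)) * z ^ n
     = of_real (deriv_coeff n) * z ^ n" for n
    by (simp add: deriv_coeff_def algebra_simps)
  ultimately show ?thesis
    unfolding deriv_eval_series by (simp add: sums_iff)
qed

text \<open>
  Moving from \<open>1\<close> to \<open>z\<close>, with \<open>d = Re (1 - z)\<close>, the real part of \<open>h(z) = f(z)/z\<close> grows by about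
  \<open>c\<^sub>1 d\<close>, while \<open>k(z) = -(f(z)/z)'\<close> is almost constant and its modulus gains at most a small multiple of
  \<open>c\<^sub>1 d\<close>. At \<open>1\<close> the hypothesis reads \<open>h(1) \<ge> k(1)\<close>. Squares are compared because
  \<open>|k(z) - k(1)|\<close> itself is only of the order of \<open>|1 - z|\<close>, and \<open>|1 - z|\<^sup>2 \<le> 2 d\<close>.
\<close>

lemma norm_log_deriv_numerator_less:
  assumes D: "deriv_at_1 \<ge> 0" and z: "norm z < 1"
  shows "norm (log_deriv_numerator z) < norm (unit_factor z)"
proof -
  define d where "d = Re (1 - z)"
  have d: "d > 0" using z complex_Re_le_cmod[of z] by (simp add: d_def)
  have z': "norm z \<le> 1" using z by simp
  define h where "h = (\<Sum>n. (-1) ^ n * c n)"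
  define k where "k = (\<Sum>n. (-1) ^ n * (real (Suc n) * c (Suc n)))"
  define C where "C = c 1"
  have C: "C > 0" using c_pos by (simp add: C_def)
  have q: "Re (unit_factor z) \<ge> h + 4/5 * C * d"
  proof -
    have "d * (2 * \<bar>(-1) ^ 1 * c 1\<bar> - (\<Sum>n. (real n)\<^sup>2 * \<bar>(-1) ^ n * c n\<bar>)) \<le> Re (unit_factor z) - h"
      unfolding d_def unit_factor_def h_def using c_pos[of 1]
      by (intro Re_power_series_diff_at_1(2)[OF summable_h_coeff z']) simp
    moreover have "d * (4/5 * C) \<le> d * (2 * \<bar>(-1) ^ 1 * c 1\<bar> - (\<Sum>n. (real n)\<^sup>2 * \<bar>(-1) ^ n * c n\<bar>))"
      using suminf_h d unfolding abs_sign C_def by (intro mult_left_mono) auto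
    ultimately have "d * (4/5 * C) \<le> Re (unit_factor z) - h" by linarith
    then show ?thesis by (simp add: mult_ac)
  qed
  have dist: "norm (log_deriv_numerator w - of_real k) \<le> norm (1 - w) * (1/100 * C)" if "norm w \<le> 1" for w
  proof -
    have "norm (log_deriv_numerator w - of_real k)
       \<le> norm (1 - w) * (\<Sum>n. (real n)\<^sup>2 * \<bar>(-1) ^ n * (real (Suc n) * c (Suc n))\<bar>)"
      unfolding log_deriv_numerator_def k_def by (rule norm_power_series_diff_at_1_le[OF summable_k_coeff that])
    also have "\<dots> \<le> norm (1 - w) * (1/100 * C)"
      using suminf_k unfolding abs_sign C_def by (intro mult_left_mono) auto
    finally show ?thesis .
  qed
  have Re_dist: "Re (log_deriv_numerator z) - k \<le> d * (1/100 * C)"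
  proof -
    have "\<bar>Re (log_deriv_numerator z) - k\<bar> \<le> d * (\<Sum>n. (real n)\<^sup>2 * \<bar>(-1) ^ n * (real (Suc n) * c (Suc n))\<bar>)"
      unfolding log_deriv_numerator_def k_def d_def by (rule Re_power_series_diff_at_1(1)[OF summable_k_coeff z'])
    also have "\<dots> \<le> d * (1/100 * C)"
      using suminf_k d unfolding abs_sign C_def by (intro mult_left_mono) auto
    finally show ?thesis by linarith
  qed
  \<comment> \<open>a lower bound for \<open>k(1)\<close> from \<open>k(0) = c\<^sub>1\<close>\<close>
  have "log_deriv_numerator 0 = of_real C"
    unfolding log_deriv_numerator_def by (subst powser_zero) (simp add: C_def)
  then have "norm (of_real (C - k) :: complex) \<le> 1/100 * C"
    using dist[of 0] by simp
  then have k: "k \<ge> 99/100 * C" unfolding norm_of_real by linarith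
  have "complex_of_real deriv_at_1 = unit_factor 1 - log_deriv_numerator 1"
    using deriv_eval_series_decomp[of 1] by (simp add: deriv_at_1)
  moreover have "log_deriv_numerator 1 = of_real k" using dist[of 1] by simp
  moreover have "unit_factor 1 = of_real h"
    using norm_power_series_diff_at_1_le[OF summable_h_coeff, of 1] by (simp add: unit_factor_def h_def)
  ultimately have hk: "h \<ge> k" using D by (metis diff_ge_0_iff_ge of_real_diff of_real_eq_iff)
  \<comment> \<open>the cross term \<open>2 k Re m\<close> is of order \<open>d\<close> by \<open>Re_dist\<close>, and so is \<open>|m|\<^sup>2\<close>\<close>
  define m where "m = log_deriv_numerator z - of_real k"
  have m: "Re m \<le> 1/100 * C * d" using Re_dist by (simp add: m_def mult_ac)
  have "(norm m)\<^sup>2 \<le> (norm (1 - z) * (1/100 * C))\<^sup>2"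
    using dist[OF z'] unfolding m_def by (intro power_mono) auto
  also have "\<dots> = (norm (1 - z))\<^sup>2 * (1/100 * C)\<^sup>2" by (rule power_mult_distrib)
  also have "\<dots> \<le> (2 * d) * (1/100 * C)\<^sup>2"
    unfolding d_def by (intro mult_right_mono norm_one_minus_squared_le z') auto
  finally have m2: "(norm m)\<^sup>2 \<le> 2/10000 * (C * d) * C" by (simp add: power2_eq_square mult_ac)
  have "log_deriv_numerator z = of_real k + m" by (simp add: m_def)
  then have "(norm (log_deriv_numerator z))\<^sup>2 = k\<^sup>2 + 2 * k * Re m + (norm m)\<^sup>2"
    unfolding cmod_power2 by (simp add: power2_eq_square algebra_simps)
  also have "\<dots> \<le> k\<^sup>2 + 2 * k * (1/100 * C * d) + 2/10000 * (C * d) * C"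
    using m m2 k C by (intro add_mono mult_left_mono) auto
  also have "\<dots> < k\<^sup>2 + 2 * k * (4/5 * C * d)"
  proof -
    have "C * d > 0" using C d by simp
    moreover have "2/10000 * C < 158/100 * k" using k C by simp
    ultimately have "(C * d) * (2/10000 * C) < (C * d) * (158/100 * k)" by (rule mult_strict_left_mono[rotated])
    then show ?thesis by (simp add: algebra_simps)
  qed
  also have "\<dots> \<le> (k + 4/5 * C * d)\<^sup>2"
    unfolding power2_sum using zero_le_power2[of "4/5 * C * d"] by linarith
  also have "\<dots> \<le> (Re (unit_factor z))\<^sup>2"
    using q hk k C d by (intro power_mono) auto
  also have "\<dots> \<le> (norm (unit_factor z))\<^sup>2" by (simp add: cmod_power2)
  finally show ?thesis by (rule power_less_imp_less_base) simp
qed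

lemma starlike_eval_series_iff: "starlike_on_disc (eval_fps series) \<longleftrightarrow> deriv_at_1 \<ge> 0"
proof
  assume "starlike_on_disc (eval_fps series)"
  then have "inj_on (eval_fps series) (ball 0 1)" by (simp add: starlike_on_disc_def)
  then show "deriv_at_1 \<ge> 0" using not_inj_on_eval_series by force
next
  assume D: "deriv_at_1 \<ge> 0"
  show "starlike_on_disc (eval_fps series)"
  proof (rule starlike_of_Re_log_deriv_pos)
    show "eval_fps series holomorphic_on ball 0 1"
      by (intro holomorphic_on_eval_fps) (simp add: fps_conv_radius_series)
    show "eval_fps series 0 = 0" by (simp add: eval_series)
    show "inj_on (eval_fps series) (ball 0 1)" by (rule inj_on_eval_series[OF D])
    fix z :: complex assume z: "z \<in> ball 0 1" "z \<noteq> 0"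
    define x where "x = z * log_deriv_numerator z / unit_factor z"
    have less: "norm (log_deriv_numerator z) < norm (unit_factor z)"
      using norm_log_deriv_numerator_less[OF D] z by simp
    then have nz: "unit_factor z \<noteq> 0" by auto
    have "norm (z * log_deriv_numerator z) \<le> 1 * norm (log_deriv_numerator z)"
      unfolding norm_mult using z by (intro mult_right_mono) auto
    then have "norm x < 1" using less nz by (simp add: x_def norm_divide divide_less_eq)
    moreover have "z * deriv (eval_fps series) z / eval_fps series z = 1 - x"
      using z nz by (simp add: deriv_eval_series_decomp eval_series x_def diff_divide_distrib)
    ultimately show "Re (z * deriv (eval_fps series) z / eval_fps series z) > 0"
      using complex_Re_le_cmod[of x] by simp
  qed
qed

end

section \<open>The derivative at 1 as a function of the order\<close>

definition cross_coeff :: "real \<Rightarrow> nat \<Rightarrow> real" where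
  "cross_coeff \<nu> n = 1 / (16 ^ n * fact n * pochhammer (\<nu> + 1) n * pochhammer (\<nu> + 2) (2 * n))"

lemma cross_coeff_pos: "\<nu> > -1 \<Longrightarrow> cross_coeff \<nu> n > 0"
  unfolding cross_coeff_def by (intro divide_pos_pos mult_pos_pos pochhammer_pos) auto

lemma cross_coeff_Suc:
  assumes "\<nu> > -1"
  shows "cross_coeff \<nu> n = 16 * (real n + 1) * (\<nu> + 1 + real n) * (\<nu> + 2 + 2 * real n) * (\<nu> + 3 + 2 * real n)
     * cross_coeff \<nu> (Suc n)"
proof -
  let ?p = "pochhammer (\<nu> + 1) n" and ?q = "pochhammer (\<nu> + 2) (2 * n)"
  have p: "pochhammer (\<nu> + 1) (Suc n) = ?p * (\<nu> + 1 + real n)"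
    by (simp add: pochhammer_rec')
  have q: "pochhammer (\<nu> + 2) (2 * Suc n) = ?q * (\<nu> + 2 + 2 * real n) * (\<nu> + 3 + 2 * real n)"
    by (simp add: pochhammer_rec' mult_ac add_ac)
  have nz: "\<nu> + 1 + real n \<noteq> 0" "\<nu> + 2 + 2 * real n \<noteq> 0" "\<nu> + 3 + 2 * real n \<noteq> 0" "real n + 1 \<noteq> 0"
    using assms by linarith+
  have alg: "1 / (t * f * u * v) = 16 * w * x * y * z * (1 / ((16 * t) * (w * f) * (u * x) * (v * y * z)))"
    if "w \<noteq> 0" "x \<noteq> 0" "y \<noteq> 0" "z \<noteq> 0" for t f u v w x y z :: real
    using that by simp
  have f: "fact (Suc n) = (real n + 1) * (fact n :: real)" by simp
  show ?thesis
    unfolding cross_coeff_def p q f power_Suc by (rule alg[OF nz(4,1,2,3)])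
qed

text \<open>
  The factors \<open>\<nu> + 1 + n > n\<close>, \<open>\<nu> + 2 + 2 n > 3\<close> and \<open>\<nu> + 3 + 2 n > 4\<close> of the quotient of
  consecutive coefficients are estimated at the limit \<open>\<nu> = -1\<close>.
\<close>

lemma rapid_alternating_cross_coeff:
  assumes "\<nu> > -1"
  shows "rapid_alternating_series (cross_coeff \<nu>)"
proof
  show "cross_coeff \<nu> 0 = 1" by (simp add: cross_coeff_def)
  show "cross_coeff \<nu> n > 0" for n by (rule cross_coeff_pos[OF assms])
  fix n :: nat assume n: "n \<ge> 1"
  then have n': "real n \<ge> 1" by simp
  have 0: "2 * real n \<le> (real n + 1) * (\<nu> + 1 + real n)"
    using n' assms by (intro mult_mono) auto
  have 1: "2 * real n * 3 \<le> (real n + 1) * (\<nu> + 1 + real n) * (\<nu> + 2 + 2 * real n)"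
    by (rule mult_mono[OF 0]) (use n' assms in auto)
  have "2 * real n * 3 * 4 \<le> (real n + 1) * (\<nu> + 1 + real n) * (\<nu> + 2 + 2 * real n) * (\<nu> + 3 + 2 * real n)"
    by (rule mult_mono[OF 1]) (use n' assms in auto)
  then have "384 * real n \<le> 16 * (real n + 1) * (\<nu> + 1 + real n) * (\<nu> + 2 + 2 * real n) * (\<nu> + 3 + 2 * real n)"
    by (simp only: mult.assoc)
  then have "384 * real n * cross_coeff \<nu> (Suc n) \<le> 
     16 * (real n + 1) * (\<nu> + 1 + real n) * (\<nu> + 2 + 2 * real n) * (\<nu> + 3 + 2 * real n) * cross_coeff \<nu> (Suc n)"
    using cross_coeff_pos[OF assms, of "Suc n"] by (intro mult_right_mono) auto
  then show "384 * real n * cross_coeff \<nu> (Suc n) \<le> cross_coeff \<nu> n"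
    using cross_coeff_Suc[OF assms, of n] by simp
qed

definition cross_deriv_at_1 :: "real \<Rightarrow> real" where
  "cross_deriv_at_1 \<nu> = rapid_alternating_series.deriv_at_1 (cross_coeff \<nu>)"

definition deriv_term :: "nat \<Rightarrow> real \<Rightarrow> real" where
  "deriv_term n \<nu> = real (Suc n) * cross_coeff \<nu> n"

definition term_ratio :: "nat \<Rightarrow> real \<Rightarrow> real" where
  "term_ratio n \<nu> = (real n + 2) / (16 * (real n + 1)\<^sup>2 * (\<nu> + 1 + real n) * (\<nu> + 2 + 2 * real n) * (\<nu> + 3 + 2 * real n))"

lemma deriv_term_pos: "\<nu> > -1 \<Longrightarrow> deriv_term n \<nu> > 0"
  using cross_coeff_pos by (simp add: deriv_term_def)

lemma deriv_term_Suc: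
  assumes "\<nu> > -1"
  shows "deriv_term (Suc n) \<nu> = term_ratio n \<nu> * deriv_term n \<nu>"
proof -
  have nz: "\<nu> + 1 + real n \<noteq> 0" "\<nu> + 2 + 2 * real n \<noteq> 0" "\<nu> + 3 + 2 * real n \<noteq> 0" "real n + 1 \<noteq> 0"
    using assms by linarith+
  have alg: "(w + 1) * k = (w + 1) / (16 * w\<^sup>2 * x * y * z) * (w * (16 * w * x * y * z * k))"
    if "w \<noteq> 0" "x \<noteq> 0" "y \<noteq> 0" "z \<noteq> 0" for w x y z k :: real
    using that by (simp add: power2_eq_square)
  have "(real n + 1 + 1) * cross_coeff \<nu> (Suc n) = (real n + 1 + 1) / (16 * (real n + 1)\<^sup>2 * (\<nu> + 1 + real n) * (\<nu> + 2 + 2 * real n) * (\<nu> + 3 + 2 * real n)) *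
      ((real n + 1) * cross_coeff \<nu> n)"
    unfolding cross_coeff_Suc[OF assms, of n] by (rule alg[OF nz(4,1,2,3)])
  then show ?thesis by (simp add: deriv_term_def term_ratio_def add_ac)
qed

lemma deriv_term_numeric:
  "deriv_term 0 \<nu> = 1"
  "-1 < \<nu> \<Longrightarrow> deriv_term 1 \<nu> = 1 / (8 * (\<nu> + 1) * (\<nu> + 2) * (\<nu> + 3))"
  "-1 < \<nu> \<Longrightarrow> deriv_term 2 \<nu> = 3 / (512 * (\<nu> + 1) * (\<nu> + 2)\<^sup>2 * (\<nu> + 3) * (\<nu> + 4) * (\<nu> + 5))"
proof -
  show "deriv_term 0 \<nu> = 1" by (simp add: deriv_term_def cross_coeff_def)
  assume "-1 < \<nu>"
  then have *: "deriv_term 1 \<nu> = term_ratio 0 \<nu> * deriv_term 0 \<nu>" "deriv_term 2 \<nu> = term_ratio 1 \<nu> * deriv_term 1 \<nu>"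
    using deriv_term_Suc[of \<nu> 0] deriv_term_Suc[of \<nu> 1] by (simp_all add: numeral_2_eq_2)
  have alg1: "2 / (16 * x * y * z) = 1 / (8 * x * y * z)" for x y z :: real
    by (simp add: mult.assoc)
  have alg2: "3 / (16 * 4 * y * v * w) * (1 / (8 * x * y * z)) = 3 / (512 * x * y\<^sup>2 * z * v * w)"
    for v w x y z :: real
    by (simp add: power2_eq_square mult_ac)
  show 1: "deriv_term 1 \<nu> = 1 / (8 * (\<nu> + 1) * (\<nu> + 2) * (\<nu> + 3))"
    using alg1[of "\<nu> + 1" "\<nu> + 2" "\<nu> + 3"] unfolding *(1) by (simp add: term_ratio_def deriv_term_def cross_coeff_def)
  show "deriv_term 2 \<nu> = 3 / (512 * (\<nu> + 1) * (\<nu> + 2)\<^sup>2 * (\<nu> + 3) * (\<nu> + 4) * (\<nu> + 5))"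
    using alg2[of "\<nu> + 2" "\<nu> + 4" "\<nu> + 5" "\<nu> + 1" "\<nu> + 3"]
    unfolding *(2) 1 by (simp add: term_ratio_def add_ac)
qed

lemma term_ratio_pos: "\<nu> > -1 \<Longrightarrow> term_ratio n \<nu> > 0"
  unfolding term_ratio_def by (intro divide_pos_pos mult_pos_pos) (auto intro: zero_less_power)

lemma term_ratio_antimono:
  assumes "-1 < \<mu>" "\<mu> \<le> \<nu>"
  shows "term_ratio n \<nu> \<le> term_ratio n \<mu>"
  unfolding term_ratio_def using assms
  by (intro divide_left_mono mult_mono mult_pos_pos mult_nonneg_nonneg) (auto intro: zero_less_power)

text \<open>
  Each of the three factors of the denominator exceeds \<open>\<nu> + 1\<close> by a nonnegative constant, so the
  quotient of \<open>\<nu> + 1\<close> by it increases with \<open>\<nu>\<close>.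
\<close>

lemma term_ratio_scale:
  assumes "-1 < \<mu>" "\<mu> \<le> \<nu>"
  shows "(\<mu> + 1) ^ 3 * term_ratio n \<mu> \<le> (\<nu> + 1) ^ 3 * term_ratio n \<nu>"
proof -
  define a b where "a = \<mu> + 1" and "b = \<nu> + 1"
  have ab: "0 < a" "a \<le> b" using assms by (auto simp: a_def b_def)
  have fr: "a / (a + t) \<le> b / (b + t)" if "t \<ge> 0" for t
    using ab that by (simp add: frac_le_eq divide_le_eq field_simps mult_right_mono)
  have eq: "(x + 1) ^ 3 * term_ratio n x = (real n + 2) / (16 * (real n + 1)\<^sup>2) *
     ((x + 1) / (x + 1 + real n) * ((x + 1) / (x + 1 + (1 + 2 * real n)) * ((x + 1) / (x + 1 + (2 + 2 * real n)))))" for x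
    by (simp add: term_ratio_def power3_eq_cube add_ac mult_ac)
  show ?thesis
    unfolding eq[of \<mu>] eq[of \<nu>] unfolding a_def[symmetric] b_def[symmetric]
    using ab by (intro mult_left_mono mult_mono fr mult_nonneg_nonneg) auto
qed

lemma term_ratio_le:
  assumes "-1 < \<nu>" "n \<ge> 1"
  shows "term_ratio n \<nu> \<le> 1/128"
proof -
  have n: "real n \<ge> 1" using assms by simp
  have 0: "2 * (real n + 1) \<le> (real n + 1)\<^sup>2"
    unfolding power2_eq_square using n by (intro mult_right_mono) auto
  have 1: "2 * (real n + 1) * 1 \<le> (real n + 1)\<^sup>2 * (\<nu> + 1 + real n)"
    by (rule mult_mono[OF 0]) (use n assms in auto)
  have 2: "2 * (real n + 1) * 1 * 3 \<le> (real n + 1)\<^sup>2 * (\<nu> + 1 + real n) * (\<nu> + 2 + 2 * real n)"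
    by (rule mult_mono[OF 1]) (use n assms in auto)
  have "2 * (real n + 1) * 1 * 3 * 4 \<le> (real n + 1)\<^sup>2 * (\<nu> + 1 + real n) * (\<nu> + 2 + 2 * real n) * (\<nu> + 3 + 2 * real n)"
    by (rule mult_mono[OF 2]) (use n assms in auto)
  moreover have "128 * (real n + 2) \<le> 16 * P" if "2 * (real n + 1) * 1 * 3 * 4 \<le> P" for P
    using that n by simp
  ultimately have "128 * (real n + 2) \<le> 16 * ((real n + 1)\<^sup>2 * (\<nu> + 1 + real n) * (\<nu> + 2 + 2 * real n) * (\<nu> + 3 + 2 * real n))"
    by blast
  then have "128 * (real n + 2) \<le> 16 * (real n + 1)\<^sup>2 * (\<nu> + 1 + real n) * (\<nu> + 2 + 2 * real n) * (\<nu> + 3 + 2 * real n)"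
    by (simp only: mult.assoc)
  moreover have "0 < 16 * (real n + 1)\<^sup>2 * (\<nu> + 1 + real n) * (\<nu> + 2 + 2 * real n) * (\<nu> + 3 + 2 * real n)"
    using assms n by (intro mult_pos_pos) auto
  ultimately show ?thesis unfolding term_ratio_def by (simp add: divide_le_eq)
qed

text \<open>
  The factor \<open>1/(\<nu> + 1)\<close> of \<open>t\<^sub>1\<close> is inherited by all later terms, as the ratios of consecutive
  terms decrease with \<open>\<nu>\<close>.
\<close>

lemma deriv_term_scale:
  assumes "-1 < \<mu>" "\<mu> \<le> \<nu>" "n \<ge> 1"
  shows "(\<nu> + 1) * deriv_term n \<nu> \<le> (\<mu> + 1) * deriv_term n \<mu>"
  using assms(3)
proof (induction n rule: dec_induct)
  case base
  have eq: "(x + 1) * deriv_term 1 x = 1 / 8 / ((x + 2) * (x + 3))" if "-1 < x" for x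
  proof -
    have "a * (1 / (8 * a * y * z)) = 1 / 8 / (y * z)" if "a \<noteq> 0" for a y z :: real
      using that by simp
    from this[of "x + 1" "x + 2" "x + 3"] that show ?thesis unfolding deriv_term_numeric(2)[OF that] by simp
  qed
  have "1 / 8 / ((\<nu> + 2) * (\<nu> + 3)) \<le> 1 / 8 / ((\<mu> + 2) * (\<mu> + 3))"
    using assms by (intro divide_left_mono mult_mono mult_pos_pos) auto
  then show ?case using assms eq by simp
next
  case (step n)
  have "(\<nu> + 1) * deriv_term (Suc n) \<nu> = term_ratio n \<nu> * ((\<nu> + 1) * deriv_term n \<nu>)"
    using assms by (simp add: deriv_term_Suc)
  also have "\<dots> \<le> term_ratio n \<mu> * ((\<mu> + 1) * deriv_term n \<mu>)"
    by (rule mult_mono[OF term_ratio_antimono[OF assms(1,2)] step.IH])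
       (use assms term_ratio_pos[of \<mu> n] deriv_term_pos[of \<nu> n] in auto)
  also have "\<dots> = (\<mu> + 1) * deriv_term (Suc n) \<mu>"
    using assms by (simp add: deriv_term_Suc)
  finally show ?case .
qed

lemma deriv_term_antimono:
  assumes "-1 < \<mu>" "\<mu> \<le> \<nu>"
  shows "deriv_term n \<nu> \<le> deriv_term n \<mu>"
proof (cases "n = 0")
  case False
  have "(\<mu> + 1) * deriv_term n \<nu> \<le> (\<nu> + 1) * deriv_term n \<nu>"
    using assms deriv_term_pos[of \<nu> n] by (intro mult_right_mono) auto
  also have "\<dots> \<le> (\<mu> + 1) * deriv_term n \<mu>" using assms False by (intro deriv_term_scale) auto
  finally show ?thesis using assms by simp
qed (simp add: deriv_term_def cross_coeff_def)

text \<open>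
  Let \<open>s = (\<mu> + 1)/(\<nu> + 1) < 1\<close>. Passing from \<open>\<mu>\<close> to \<open>\<nu>\<close> multiplies \<open>t\<^sub>n\<close> by at most \<open>s\<close> and the
  ratio \<open>r = t\<^sub>n\<^sub>+\<^sub>1 / t\<^sub>n\<close> by at least \<open>s\<^sup>3\<close>. Hence \<open>t\<^sub>n (1 - r)\<close> decreases as soon as
  \<open>s (1 - s\<^sup>3 r) < 1 - r\<close>, which is \<open>r (1 + s) (1 + s\<^sup>2) < 1\<close> after division by \<open>1 - s\<close>.
\<close>

lemma deriv_term_pair_strict_antimono:
  assumes "-1 < \<mu>" "\<mu> < \<nu>" "n \<ge> 1"
  shows "deriv_term n \<nu> - deriv_term (Suc n) \<nu> < deriv_term n \<mu> - deriv_term (Suc n) \<mu>"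
proof -
  define s where "s = (\<mu> + 1) / (\<nu> + 1)"
  define r where "r = term_ratio n \<mu>"
  have \<nu>: "-1 < \<nu>" using assms by simp
  have s: "0 < s" "s < 1" using assms by (auto simp: s_def)
  have r: "0 < r" "r \<le> 1/128" using term_ratio_pos term_ratio_le assms by (auto simp: r_def)
  have rs: "s ^ 3 * r \<le> term_ratio n \<nu>"
    using term_ratio_scale[of \<mu> \<nu> n] assms unfolding s_def r_def by (simp add: power_divide divide_le_eq mult_ac)
  have ts: "deriv_term n \<nu> \<le> s * deriv_term n \<mu>"
    using deriv_term_scale[of \<mu> \<nu> n] assms unfolding s_def by (simp add: le_divide_eq mult_ac)
  have "s * (1 - s ^ 3 * r) < 1 - r"
  proof -
    have "(1 + s) * (1 + s\<^sup>2) \<le> 2 * 2" using s by (intro mult_mono) (auto intro: power_le_one)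
    then have "r * ((1 + s) * (1 + s\<^sup>2)) \<le> 1/128 * 4" using s r by (intro mult_mono) auto
    then have "0 < (1 - s) * (1 - r * ((1 + s) * (1 + s\<^sup>2)))" using s by (intro mult_pos_pos) auto
    then show ?thesis by (simp add: algebra_simps power2_eq_square power3_eq_cube)
  qed
  have "deriv_term n \<nu> - deriv_term (Suc n) \<nu> = deriv_term n \<nu> * (1 - term_ratio n \<nu>)"
    using \<nu> by (simp add: deriv_term_Suc algebra_simps)
  also have "\<dots> \<le> deriv_term n \<nu> * (1 - s ^ 3 * r)"
    using rs deriv_term_pos[OF \<nu>, of n] by (intro mult_left_mono) auto
  also have "\<dots> \<le> s * deriv_term n \<mu> * (1 - s ^ 3 * r)"
  proof (rule mult_right_mono[OF ts])
    have "s ^ 3 * r \<le> 1 * (1/128)" using s r by (intro mult_mono power_le_one) auto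
    then show "0 \<le> 1 - s ^ 3 * r" by simp
  qed
  also have "\<dots> = deriv_term n \<mu> * (s * (1 - s ^ 3 * r))" by simp
  also have "\<dots> < deriv_term n \<mu> * (1 - r)"
    using \<open>s * (1 - s ^ 3 * r) < 1 - r\<close> deriv_term_pos[OF assms(1), of n] by (rule mult_strict_left_mono)
  also have "\<dots> = deriv_term n \<mu> - deriv_term (Suc n) \<mu>"
    using assms by (simp add: deriv_term_Suc r_def algebra_simps)
  finally show ?thesis .
qed

lemma summable_deriv_term:
  assumes "-1 < \<nu>"
  shows "summable (\<lambda>n. deriv_term n \<nu>)"
proof -
  interpret rapid_alternating_series "cross_coeff \<nu>"
    by (rule rapid_alternating_cross_coeff[OF assms])
  have "summable (\<lambda>n. \<bar>deriv_coeff n\<bar>)"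
    by (rule summable_abs_of_square_weight[OF summable_deriv_coeff])
  then show ?thesis by (simp only: abs_deriv_coeff deriv_term_def)
qed

lemma cross_deriv_at_1_sums:
  assumes "-1 < \<nu>"
  shows "(\<lambda>n. (-1) ^ n * deriv_term n \<nu>) sums cross_deriv_at_1 \<nu>"
proof -
  interpret rapid_alternating_series "cross_coeff \<nu>"
    by (rule rapid_alternating_cross_coeff[OF assms])
  have abs: "(\<lambda>n. \<bar>(-1) ^ n * deriv_term n \<nu>\<bar>) = (\<lambda>n. deriv_term n \<nu>)"
    using deriv_term_pos[OF assms] by (simp add: abs_mult abs_of_pos)
  have "summable (\<lambda>n. (-1) ^ n * deriv_term n \<nu>)"
    by (rule summable_rabs_cancel[of "\<lambda>n. (-1) ^ n * deriv_term n \<nu>"]) (simp only: abs summable_deriv_term[OF assms])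
  then show ?thesis unfolding cross_deriv_at_1_def deriv_at_1_def deriv_coeff_def deriv_term_def by (rule summable_sums)
qed

lemma cross_deriv_at_1_pairs:
  assumes "-1 < \<nu>"
  shows "(\<lambda>n. deriv_term (2 * n + 1) \<nu> - deriv_term (2 * n + 2) \<nu>) sums (1 - cross_deriv_at_1 \<nu>)"
proof -
  have "(\<lambda>n. (-1) ^ Suc n * deriv_term (Suc n) \<nu>) sums (cross_deriv_at_1 \<nu> - 1)"
    using cross_deriv_at_1_sums[OF assms]
    by (subst sums_Suc_iff[of "\<lambda>n. (-1) ^ n * deriv_term n \<nu>"]) (simp add: deriv_term_numeric(1))
  from sums_group[OF this, of 2] have "(\<lambda>n. \<Sum>k = n * 2..<n * 2 + 2. (-1) ^ Suc k * deriv_term (Suc k) \<nu>) sums (cross_deriv_at_1 \<nu> - 1)"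
    by simp
  moreover have "- (\<Sum>k = n * 2..<n * 2 + 2. (-1) ^ Suc k * deriv_term (Suc k) \<nu>) = deriv_term (2 * n + 1) \<nu> - deriv_term (2 * n + 2) \<nu>" for n
  proof -
    have "{n * 2..<n * 2 + 2} = {2 * n, 2 * n + 1}" by auto
    then show ?thesis by simp
  qed
  ultimately show ?thesis using sums_minus by fastforce
qed

lemma cross_deriv_at_1_strict_mono:
  assumes "-1 < \<mu>" "\<mu> < \<nu>"
  shows "cross_deriv_at_1 \<mu> < cross_deriv_at_1 \<nu>"
proof -
  have "\<nu> > -1" using assms by simp
  let ?p = "\<lambda>\<nu> n. deriv_term (2 * n + 1) \<nu> - deriv_term (2 * n + 2) \<nu>"
  have lt: "?p \<nu> n < ?p \<mu> n" for n
    using deriv_term_pair_strict_antimono[OF assms, of "2 * n + 1"] by simp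
  have S: "(\<lambda>n. ?p \<mu> n - ?p \<nu> n) sums (cross_deriv_at_1 \<nu> - cross_deriv_at_1 \<mu>)"
    using sums_diff[OF cross_deriv_at_1_pairs[OF assms(1)] cross_deriv_at_1_pairs[OF \<open>\<nu> > -1\<close>]] by simp
  have "0 < (\<Sum>n. ?p \<mu> n - ?p \<nu> n)"
    using lt S by (intro suminf_pos sums_summable[OF S]) (simp add: algebra_simps)
  then show ?thesis using S by (simp add: sums_iff)
qed

text \<open>
  As every term decreases with the order, its value at the left end point serves in the M-test.
\<close>

lemma cross_deriv_at_1_continuous:
  assumes "-1 < \<mu>"
  shows "continuous_on {\<mu>..} cross_deriv_at_1"
proof -
  have ul: "uniform_limit {\<mu>..} (\<lambda>n \<nu>. \<Sum>i<n. (-1) ^ i * deriv_term i \<nu>) (\<lambda>\<nu>. \<Sum>i. (-1) ^ i * deriv_term i \<nu>) sequentially"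
  proof (rule Weierstrass_m_test)
    fix n \<nu> assume "\<nu> \<in> {\<mu>..}"
    then show "norm ((-1) ^ n * deriv_term n \<nu>) \<le> deriv_term n \<mu>"
      using assms deriv_term_pos[of \<nu> n] deriv_term_antimono[of \<mu> \<nu> n] by (simp add: abs_mult)
  qed (rule summable_deriv_term[OF assms])
  have cont: "continuous_on {\<mu>..} (\<lambda>\<nu>. \<Sum>i<n. (-1) ^ i * deriv_term i \<nu>)" for n
  proof -
    have "16 ^ i * fact i * pochhammer (\<nu> + 1) i * pochhammer (\<nu> + 2) (2 * i) \<noteq> 0" if "\<nu> \<in> {\<mu>..}" for i \<nu>
      using that assms pochhammer_pos[of "\<nu> + 1" i] pochhammer_pos[of "\<nu> + 2" "2 * i"] by auto
    then show ?thesis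
      unfolding deriv_term_def cross_coeff_def
      by (intro continuous_intros) auto
  qed
  from ul have "continuous_on {\<mu>..} (\<lambda>\<nu>. \<Sum>i. (-1) ^ i * deriv_term i \<nu>)"
    by (rule uniform_limit_theorem[rotated]) (simp_all add: cont)
  moreover have "cross_deriv_at_1 \<nu> = (\<Sum>i. (-1) ^ i * deriv_term i \<nu>)" if "\<nu> \<in> {\<mu>..}" for \<nu>
    using cross_deriv_at_1_sums[of \<nu>] that assms by (simp add: sums_iff)
  ultimately show ?thesis by (subst continuous_on_cong) auto
qed

lemma deriv_term_Suc_le: "-1 < \<nu> \<Longrightarrow> n \<ge> 1 \<Longrightarrow> deriv_term (Suc n) \<nu> \<le> deriv_term n \<nu>"
  using term_ratio_le[of \<nu> n] deriv_term_pos[of \<nu> n] by (simp add: deriv_term_Suc)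

lemma cross_deriv_at_1_upper:
  assumes "-1 < \<nu>"
  shows "cross_deriv_at_1 \<nu> \<le> 1 - deriv_term 1 \<nu> + deriv_term 2 \<nu>"
proof -
  have "(\<Sum>n<1. deriv_term (2 * n + 1) \<nu> - deriv_term (2 * n + 2) \<nu>) \<le> (\<Sum>n. deriv_term (2 * n + 1) \<nu> - deriv_term (2 * n + 2) \<nu>)"
    using cross_deriv_at_1_pairs[OF assms] deriv_term_Suc_le[OF assms]
    by (intro sum_le_suminf) (auto simp: sums_iff)
  then show ?thesis using cross_deriv_at_1_pairs[OF assms] by (simp add: sums_iff numeral_2_eq_2)
qed

text \<open>
  The fraction \<open>9/10\<close> of the third term leaves room for the rest of the series and is still enough
  for the sign at \<open>-0.9427\<close>.
\<close>

lemma cross_deriv_at_1_lower: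
  assumes "-1 < \<nu>"
  shows "cross_deriv_at_1 \<nu> \<ge> 1 - deriv_term 1 \<nu> + 9/10 * deriv_term 2 \<nu>"
proof -
  have S: "(\<lambda>n. (-1) ^ (n + 3) * deriv_term (n + 3) \<nu>) sums (cross_deriv_at_1 \<nu> - (1 - deriv_term 1 \<nu> + deriv_term 2 \<nu>))"
    using cross_deriv_at_1_sums[OF assms]
    by (subst sums_iff_shift) (simp add: numeral_3_eq_3 numeral_2_eq_2 deriv_term_def cross_coeff_def)
  have le: "deriv_term (n + 3) \<nu> \<le> deriv_term 2 \<nu> * (1/128) ^ Suc n" for n
  proof (induction n)
    case 0
    have "deriv_term 3 \<nu> = term_ratio 2 \<nu> * deriv_term 2 \<nu>" using deriv_term_Suc[OF assms, of 2] by (simp add: numeral_3_eq_3)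
    also have "\<dots> \<le> 1/128 * deriv_term 2 \<nu>"
      using term_ratio_le[OF assms, of 2] deriv_term_pos[OF assms, of 2] by (intro mult_right_mono) auto
    finally show ?case by simp
  next
    case (Suc n)
    have "deriv_term (Suc n + 3) \<nu> = term_ratio (n + 3) \<nu> * deriv_term (n + 3) \<nu>" using deriv_term_Suc[OF assms, of "n + 3"] by simp
    also have "\<dots> \<le> 1/128 * (deriv_term 2 \<nu> * (1/128) ^ Suc n)"
      using term_ratio_le[OF assms, of "n + 3"] deriv_term_pos[OF assms, of "n + 3"] Suc by (intro mult_mono) auto
    finally show ?case by simp
  qed
  have G: "(\<lambda>n. deriv_term 2 \<nu> * (1/128) * (1/128) ^ n) sums (deriv_term 2 \<nu> * (1/128) * (1 / (1 - 1/128)))"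
    by (intro sums_mult geometric_sums) simp
  have "- (deriv_term 2 \<nu> * (1/128) * (1 / (1 - 1/128))) \<le> cross_deriv_at_1 \<nu> - (1 - deriv_term 1 \<nu> + deriv_term 2 \<nu>)"
  proof (rule sums_le[OF _ sums_minus[OF G] S])
    fix n
    have "\<bar>(-1) ^ (n + 3) * deriv_term (n + 3) \<nu>\<bar> \<le> deriv_term 2 \<nu> * (1/128) * (1/128) ^ n"
      using le[of n] deriv_term_pos[OF assms, of "n + 3"] by (simp add: abs_mult)
    then show "- (deriv_term 2 \<nu> * (1/128) * (1/128) ^ n) \<le> (-1) ^ (n + 3) * deriv_term (n + 3) \<nu>"
      by linarith
  qed
  then show ?thesis using deriv_term_pos[OF assms, of 2] by simp
qed

text \<open>
  The first two terms nearly cancel at the root, so the third one is needed for its fourth decimal.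
\<close>

lemma cross_deriv_at_1_root:
  obtains s where "-0.9428 < s" "s \<le> -0.9427" "cross_deriv_at_1 s = 0"
proof -
  have l: "cross_deriv_at_1 (-0.9428) < 0"
  proof -
    have "cross_deriv_at_1 (-0.9428) \<le> 1 - deriv_term 1 (-0.9428) + deriv_term 2 (-0.9428)"
      by (rule cross_deriv_at_1_upper) simp
    also have "\<dots> < 0" by (simp add: deriv_term_numeric power2_eq_square del: One_nat_def)
    finally show ?thesis .
  qed
  have r: "cross_deriv_at_1 (-0.9427) \<ge> 0"
  proof -
    have "0 \<le> 1 - deriv_term 1 (-0.9427) + 9/10 * deriv_term 2 (-0.9427)" by (simp add: deriv_term_numeric power2_eq_square del: One_nat_def)
    also have "\<dots> \<le> cross_deriv_at_1 (-0.9427)"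
      by (rule cross_deriv_at_1_lower) simp
    finally show ?thesis .
  qed
  have "continuous_on {-0.9428..-0.9427} cross_deriv_at_1"
    by (rule continuous_on_subset[OF cross_deriv_at_1_continuous[of "-0.9428"]]) auto
  then obtain s where "-0.9428 \<le> s" "s \<le> -0.9427" "cross_deriv_at_1 s = 0"
    using IVT'[of cross_deriv_at_1 "-0.9428" 0 "-0.9427"] l r by auto
  then show ?thesis using that[of s] l by (cases "s = -0.9428") auto
qed

section \<open>The normalized cross product of Bessel functions\<close>

lemma eval_fps_bessel_fps:
  "eval_fps (bessel_fps s a) x = (\<Sum>n. s ^ n * rGamma (a + of_nat n + 1) / fact n * x ^ n)"
  by (simp add: eval_fps_def bessel_fps_def)

lemma
  assumes "Re a > -1"
  shows fps_conv_radius_bessel_product: "fps_conv_radius (bessel_product a) = \<infinity>"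
    and eval_bessel_product:
      "eval_fps (bessel_product a) x = eval_fps (bessel_fps (-1) a) x * eval_fps (bessel_fps 1 a) x"
    and fps_conv_radius_bessel_cross_product: "fps_conv_radius (bessel_cross_product a) = \<infinity>"
    and eval_bessel_cross_product: "eval_fps (bessel_cross_product a) x =
       eval_fps (bessel_fps (-1) (a + 1)) x * eval_fps (bessel_fps 1 a) x
       + eval_fps (bessel_fps (-1) a) x * eval_fps (bessel_fps 1 (a + 1)) x"
proof -
  have r: "fps_conv_radius (bessel_fps s a) = \<infinity>" "fps_conv_radius (bessel_fps s (a + 1)) = \<infinity>" for s
    using assms by (simp_all add: fps_conv_radius_bessel_fps)
  have m: "fps_conv_radius (F * G) = \<infinity>" if "fps_conv_radius F = \<infinity>" "fps_conv_radius G = \<infinity>"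
    for F G :: "complex fps"
    using fps_conv_radius_mult[of F G] that by simp
  have p: "fps_conv_radius (F + G) = \<infinity>" if "fps_conv_radius F = \<infinity>" "fps_conv_radius G = \<infinity>"
    for F G :: "complex fps"
    using fps_conv_radius_add[of F G] that by simp
  show "fps_conv_radius (bessel_product a) = \<infinity>"
    unfolding bessel_product_def by (intro m r)
  show "eval_fps (bessel_product a) x = eval_fps (bessel_fps (-1) a) x * eval_fps (bessel_fps 1 a) x"
    unfolding bessel_product_def by (rule eval_fps_mult) (simp_all add: r)
  show "fps_conv_radius (bessel_cross_product a) = \<infinity>"
    unfolding bessel_cross_product_def by (intro m p r)
  show "eval_fps (bessel_cross_product a) x =
       eval_fps (bessel_fps (-1) (a + 1)) x * eval_fps (bessel_fps 1 a) x
       + eval_fps (bessel_fps (-1) a) x * eval_fps (bessel_fps 1 (a + 1)) x"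
    unfolding bessel_cross_product_def
    by (subst eval_fps_add) (simp_all add: m r eval_fps_mult)
qed

text \<open>
  The power \<open>16 ^ n\<close> disappears in the variable \<open>16 x\<^sup>2\<close>, which is \<open>z\<close> for \<open>x = (z^(1/4) / 2)\<^sup>2\<close>.
\<close>

lemma bessel_cross_product_even_real:
  assumes "\<nu> > -1"
  shows "fps_nth (bessel_cross_product (of_real \<nu>)) (2 * n) =
     2 * of_real (rGamma (\<nu> + 1) * rGamma (\<nu> + 2)) * of_real ((-1) ^ n * cross_coeff \<nu> n) * 16 ^ n"
proof -
  have "rGamma (\<nu> + 1) = pochhammer (\<nu> + 1) n * rGamma (\<nu> + of_nat n + 1)"
    using pochhammer_rGamma[of "\<nu> + 1" n] by (simp add: add_ac)
  moreover have "rGamma (\<nu> + 2) = pochhammer (\<nu> + 2) (2 * n) * rGamma (\<nu> + of_nat (2 * n) + 2)"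
    using pochhammer_rGamma[of "\<nu> + 2" "2 * n"] by (simp add: add_ac)
  moreover have "pochhammer (\<nu> + 1) n > 0" "pochhammer (\<nu> + 2) (2 * n) > 0"
    using assms by (simp_all add: pochhammer_pos)
  ultimately have *: "rGamma (\<nu> + real n + 1) * rGamma (\<nu> + real (2 * n) + 2) / fact n =
      rGamma (\<nu> + 1) * rGamma (\<nu> + 2) * cross_coeff \<nu> n * 16 ^ n"
    by (simp add: cross_coeff_def field_simps)
  have a: "complex_of_real \<nu> + of_nat n + 1 = of_real (\<nu> + real n + 1)"
     "complex_of_real \<nu> + of_nat (2 * n) + 2 = of_real (\<nu> + real (2 * n) + 2)" by simp_all
  have "fps_nth (bessel_cross_product (of_real \<nu>)) (2 * n) =
     of_real (2 * (-1) ^ n * (rGamma (\<nu> + real n + 1) * rGamma (\<nu> + real (2 * n) + 2) / fact n))"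
    using assms unfolding bessel_cross_product_even[of "of_real \<nu>" n, simplified] a rGamma_complex_of_real
    by (subst bessel_cross_product_even) (simp_all add: a rGamma_complex_of_real del: of_nat_mult of_real_add)
  then show ?thesis unfolding * by (simp add: mult_ac)
qed

lemma sums_even_reindex:
  fixes F :: "nat \<Rightarrow> complex"
  assumes "F sums s" "\<And>n. F (2 * n + 1) = 0"
  shows "(\<lambda>n. F (2 * n)) sums s"
proof (subst sums_mono_reindex)
  show "strict_mono ((*) (2 :: nat))" by (auto simp: strict_mono_def)
  show "F n = 0" if "n \<notin> range ((*) 2)" for n
    using that assms(2)[of "n div 2"] by (metis odd_two_times_div_two_succ evenE rangeI)
qed (fact assms(1))

lemma eval_bessel_cross_product_sums:
  assumes "\<nu> > -1"
  shows "(\<lambda>n. 2 * of_real (rGamma (\<nu> + 1) * rGamma (\<nu> + 2)) * (of_real ((-1) ^ n * cross_coeff \<nu> n) * (16 * x\<^sup>2) ^ n))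
     sums eval_fps (bessel_cross_product (of_real \<nu>)) x"
proof -
  have "(\<lambda>m. fps_nth (bessel_cross_product (of_real \<nu>)) m * x ^ m) sums eval_fps (bessel_cross_product (of_real \<nu>)) x"
    using assms by (intro sums_eval_fps) (simp add: fps_conv_radius_bessel_cross_product)
  moreover have "fps_nth (bessel_cross_product (of_real \<nu>)) (2 * n + 1) * x ^ (2 * n + 1) = 0" for n
    using bessel_cross_product_odd[of "of_real \<nu>" n] assms by simp
  ultimately have "(\<lambda>n. fps_nth (bessel_cross_product (of_real \<nu>)) (2 * n) * x ^ (2 * n)) sums
      eval_fps (bessel_cross_product (of_real \<nu>)) x"
    by (rule sums_even_reindex[of "\<lambda>m. fps_nth (bessel_cross_product (of_real \<nu>)) m * x ^ m"])
  moreover have "(16 * x\<^sup>2) ^ n = 16 ^ n * x ^ (2 * n)" for n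
    by (simp only: power_mult power_mult_distrib)
  ultimately show ?thesis
    unfolding bessel_cross_product_even_real[OF assms] by (simp only: mult_ac)
qed

lemma f_fun_eq_series:
  assumes "\<nu> > -1"
  shows "f_fun \<nu> = eval_fps (rapid_alternating_series.series (cross_coeff \<nu>))"
proof
  fix z
  interpret rapid_alternating_series "cross_coeff \<nu>"
    by (rule rapid_alternating_cross_coeff[OF assms])
  show "f_fun \<nu> z = eval_fps series z"
  proof (cases "z = 0")
    case True
    then show ?thesis by (simp add: f_fun_def eval_series)
  next
    case False
    define x where "x = (z powr (1/4) / 2)\<^sup>2"
    have "(z powr (1/4)) ^ 4 = z"
    proof -
      have "(z powr (1/4)) ^ 4 = exp (1/4 * Ln z) ^ 4" using False by (simp add: powr_def)
      also have "\<dots> = exp (Ln z)" by (subst exp_of_nat_mult[symmetric]) simp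
      finally show ?thesis using False by simp
    qed
    then have x2: "16 * x\<^sup>2 = z" by (simp add: x_def power_divide flip: power_mult)
    have J: "(\<Sum>n. (- 1) ^ n * rGamma (a + of_nat n + 1) / fact n * (z powr (1/4) / 2) ^ (2 * n))
        = eval_fps (bessel_fps (-1) a) x" for a
      by (simp add: eval_fps_bessel_fps x_def power_mult)
    have I: "(\<Sum>n. rGamma (a + of_nat n + 1) / fact n * (z powr (1/4) / 2) ^ (2 * n))
        = eval_fps (bessel_fps 1 a) x" for a
      by (simp add: eval_fps_bessel_fps x_def power_mult)
    have "eval_fps (bessel_cross_product (of_real \<nu>)) x =
        2 * of_real (rGamma (\<nu> + 1) * rGamma (\<nu> + 2)) * unit_factor z"
    proof -
      have nz: "2 * complex_of_real (rGamma (\<nu> + 1) * rGamma (\<nu> + 2)) \<noteq> 0"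
        using assms by (simp add: rGamma_inverse_Gamma Gamma_real_pos less_imp_neq[symmetric])
      from sums_mult_D[OF eval_bessel_cross_product_sums[OF assms, of x] nz]
      show ?thesis unfolding x2 unit_factor_def using nz by (simp add: sums_iff)
    qed
    moreover have "f_fun \<nu> z = z / 2 * of_real (Gamma (\<nu> + 1) * Gamma (\<nu> + 2)) *
        eval_fps (bessel_cross_product (of_real \<nu>)) x"
      unfolding f_fun_nonzero[OF False] J I using assms by (simp add: eval_bessel_cross_product)
    moreover have "Gamma (\<nu> + 1) * rGamma (\<nu> + 1) = 1" "Gamma (\<nu> + 2) * rGamma (\<nu> + 2) = 1"
    proof -
      have "Gamma (\<nu> + 1) > 0" "Gamma (\<nu> + 2) > 0" using assms by (simp_all add: Gamma_real_pos)
      then show "Gamma (\<nu> + 1) * rGamma (\<nu> + 1) = 1" "Gamma (\<nu> + 2) * rGamma (\<nu> + 2) = 1"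
        unfolding rGamma_inverse_Gamma by (metis right_inverse less_irrefl)+
    qed
    then have "complex_of_real (Gamma (\<nu> + 1) * Gamma (\<nu> + 2)) * of_real (rGamma (\<nu> + 1) * rGamma (\<nu> + 2)) = 1"
      unfolding of_real_mult[symmetric] by (simp only: mult_ac mult.left_commute[of "rGamma (\<nu> + 1)"]) (simp add: mult.assoc[symmetric])
    ultimately have "f_fun \<nu> z = z * unit_factor z"
      by (simp add: mult_ac) 
    then show ?thesis by (simp add: eval_series)
  qed
qed

lemma
  assumes "\<nu> > -1"
  shows Bessel_J_1: "Bessel_J (of_real \<nu>) 1 = of_real ((1/2) powr \<nu>) * eval_fps (bessel_fps (-1) (of_real \<nu>)) (1/4)"
    and Bessel_I_1: "Bessel_I (of_real \<nu>) 1 = of_real ((1/2) powr \<nu>) * eval_fps (bessel_fps 1 (of_real \<nu>)) (1/4)"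
proof -
  have p: "(if complex_of_real \<nu> = 0 then 1 else (1 / 2 :: complex) powr of_real \<nu>) = of_real ((1/2) powr \<nu>)"
    using powr_of_real[of "1/2" \<nu>] by auto
  show "Bessel_J (of_real \<nu>) 1 = of_real ((1/2) powr \<nu>) * eval_fps (bessel_fps (-1) (of_real \<nu>)) (1/4)"
    unfolding Bessel_J_def p by (simp add: eval_fps_bessel_fps power_mult power2_eq_square)
  show "Bessel_I (of_real \<nu>) 1 = of_real ((1/2) powr \<nu>) * eval_fps (bessel_fps 1 (of_real \<nu>)) (1/4)"
    unfolding Bessel_I_def p by (simp add: eval_fps_bessel_fps power_mult power2_eq_square)
qed

text \<open>
  Up to the factor \<open>-p\<^sup>2 / 2\<close> with \<open>p = 2^(-\<nu>)\<close>, the difference of the two sides is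
  \<open>2 A - (\<nu> - 1) B\<close> at \<open>x = 1/4\<close>. By \<open>bessel_product_nth_eq_cross_product_nth\<close> its coefficients are
  \<open>m + 2\<close> times those of \<open>B\<close>, that is \<open>2 (n + 1)\<close> for \<open>m = 2 n\<close>, which reproduces the series
  of \<open>f\<^sub>\<nu>'(1)\<close>.
\<close>

lemma bessel_equation_iff:
  assumes "\<nu> > -1"
  shows "of_real (\<nu> - 1) * Bessel_J (of_real \<nu>) 1 * Bessel_I (of_real (\<nu> + 1)) 1
         + of_real (\<nu> - 1) * Bessel_J (of_real (\<nu> + 1)) 1 * Bessel_I (of_real \<nu>) 1
         = Bessel_J (of_real \<nu>) 1 * Bessel_I (of_real \<nu>) 1
    \<longleftrightarrow> cross_deriv_at_1 \<nu> = 0"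
proof -
  interpret rapid_alternating_series "cross_coeff \<nu>"
    by (rule rapid_alternating_cross_coeff[OF assms])
  let ?A = "eval_fps (bessel_product (of_real \<nu>)) (1/4)"
  let ?B = "eval_fps (bessel_cross_product (of_real \<nu>)) (1/4)"
  define p where "p = complex_of_real ((1/2) powr \<nu>)"
  have p: "p \<noteq> 0" by (simp add: p_def)
  have p': "complex_of_real ((1/2) powr (\<nu> + 1)) = p / 2"
    by (simp add: p_def powr_add)
  have re: "Re (of_real \<nu>) > -1" using assms by simp
  define R where "R = 2 * complex_of_real (rGamma (\<nu> + 1) * rGamma (\<nu> + 2))"
  have R: "R \<noteq> 0"
    using assms by (simp add: R_def rGamma_inverse_Gamma Gamma_real_pos less_imp_neq[symmetric])
  have key: "2 * ?A - of_real (\<nu> - 1) * ?B = R * 2 * of_real (cross_deriv_at_1 \<nu>)"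
  proof -
    define F where "F = (\<lambda>m. (2 * fps_nth (bessel_product (of_real \<nu>)) m - of_real (\<nu> - 1) * fps_nth (bessel_cross_product (of_real \<nu>)) m)
        * (1/4) ^ m)"
    have "(\<lambda>m. 2 * (fps_nth (bessel_product (of_real \<nu>)) m * (1/4) ^ m)
        - of_real (\<nu> - 1) * (fps_nth (bessel_cross_product (of_real \<nu>)) m * (1/4) ^ m))
        sums (2 * ?A - of_real (\<nu> - 1) * ?B)"
      by (intro sums_diff sums_mult sums_eval_fps)
        (simp_all add: fps_conv_radius_bessel_product[OF re] fps_conv_radius_bessel_cross_product[OF re])
    then have S: "F sums (2 * ?A - of_real (\<nu> - 1) * ?B)"
      by (simp add: F_def algebra_simps)
    have F: "F m = of_nat (m + 2) * fps_nth (bessel_cross_product (of_real \<nu>)) m * (1/4) ^ m" for m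
      unfolding F_def bessel_product_nth_eq_cross_product_nth by (simp add: algebra_simps)
    have "(\<lambda>n. F (2 * n)) sums (2 * ?A - of_real (\<nu> - 1) * ?B)"
    proof (rule sums_even_reindex[OF S])
      show "F (2 * n + 1) = 0" for n
        unfolding F using bessel_cross_product_odd[OF re, of n] by simp
    qed
    moreover have "F (2 * n) = R * 2 * of_real ((-1) ^ n * deriv_term n \<nu>)" for n
    proof -
      have "(16 :: complex) ^ n * (1/4) ^ (2 * n) = (16 * (1/4)\<^sup>2) ^ n"
        by (simp only: power_mult power_mult_distrib)
      then have "(16 :: complex) ^ n * (1/4) ^ (2 * n) = 1"
        by (simp add: power2_eq_square)
      moreover have "(2 * a) * (R * (b * c) * u) * v = R * 2 * (b * (a * c)) * (u * v)" for a b c u v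
        by (simp only: mult_ac)
      ultimately have "(2 * a) * (R * (b * c) * 16 ^ n) * (1/4) ^ (2 * n) = R * 2 * (b * (a * c))" for a b c
        by simp
      moreover have "of_nat (2 * n + 2) = 2 * complex_of_real (real (Suc n))" by simp
      ultimately show ?thesis
        unfolding F bessel_cross_product_even_real[OF assms] R_def[symmetric] deriv_term_def
        by (simp only: of_real_mult)
    qed
    ultimately have "(\<lambda>n. R * 2 * of_real ((-1) ^ n * deriv_term n \<nu>)) sums (2 * ?A - of_real (\<nu> - 1) * ?B)"
      by simp
    moreover have "(\<lambda>n. R * 2 * of_real ((-1) ^ n * deriv_term n \<nu>)) sums (R * 2 * of_real (cross_deriv_at_1 \<nu>))"
      by (intro sums_mult sums_of_real cross_deriv_at_1_sums assms)
    ultimately show ?thesis by (rule sums_unique2)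
  qed
  have "of_real (\<nu> - 1) * Bessel_J (of_real \<nu>) 1 * Bessel_I (of_real (\<nu> + 1)) 1
         + of_real (\<nu> - 1) * Bessel_J (of_real (\<nu> + 1)) 1 * Bessel_I (of_real \<nu>) 1
         - Bessel_J (of_real \<nu>) 1 * Bessel_I (of_real \<nu>) 1
     = p\<^sup>2 / 2 * (of_real (\<nu> - 1) * ?B - 2 * ?A)"
  proof -
    have "c * (p * j) * (p / 2 * i') + c * (p / 2 * j') * (p * i) - p * j * (p * i)
        = p\<^sup>2 / 2 * (c * (j' * i + j * i') - 2 * (j * i))" for c i j i' j'
      by (simp add: power2_eq_square field_simps)
    moreover have "\<nu> + 1 > -1" using assms by simp
    ultimately show ?thesis
      unfolding Bessel_J_1[OF assms] Bessel_I_1[OF assms] Bessel_J_1[OF \<open>\<nu> + 1 > -1\<close>] Bessel_I_1[OF \<open>\<nu> + 1 > -1\<close>]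
        p' p_def[symmetric] eval_bessel_product[OF re] eval_bessel_cross_product[OF re]
      by (simp only: of_real_add of_real_1)
  qed
  also have "\<dots> = - (p\<^sup>2 * R) * of_real (cross_deriv_at_1 \<nu>)"
  proof -
    have "of_real (\<nu> - 1) * ?B - 2 * ?A = - (R * 2 * of_real (cross_deriv_at_1 \<nu>))"
      unfolding key[symmetric] by (rule minus_diff_eq[symmetric])
    then show ?thesis by (simp only:) simp
  qed
  finally show ?thesis using p R
    by (metis eq_iff_diff_eq_0 mult_eq_0_iff neg_equal_0_iff_equal of_real_eq_0_iff power_not_zero)
qed


theorem theorem1:
  shows "\<exists>\<nu>s::real.
    {\<nu>::real. (-1::real) < \<nu> \<and>
       of_real (\<nu> - 1) * Bessel_J (of_real \<nu>) 1 * Bessel_I (of_real (\<nu> + 1)) 1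
         + of_real (\<nu> - 1) * Bessel_J (of_real (\<nu> + 1)) 1 * Bessel_I (of_real \<nu>) 1
         = Bessel_J (of_real \<nu>) 1 * Bessel_I (of_real \<nu>) 1} = {\<nu>s} \<and>
    -0.9428 < \<nu>s \<and> \<nu>s \<le> -0.9427 \<and>
    (\<forall>\<nu>::real. (-1::real) < \<nu> \<longrightarrow>
       (starlike_on_disc (f_fun \<nu>) \<and>
        (\<forall>k\<ge>1. close_to_convex_on_disc ((deriv ^^ k) (f_fun \<nu>))) \<longleftrightarrow> \<nu> \<ge> \<nu>s) \<and>
       (\<forall>k\<ge>1. close_to_convex_on_disc ((deriv ^^ k) (f_fun \<nu>)) \<longrightarrow>
               inj_on ((deriv ^^ k) (f_fun \<nu>)) (ball 0 1)))"
proof -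
  obtain s where s: "-0.9428 < s" "s \<le> -0.9427" "cross_deriv_at_1 s = 0"
    by (rule cross_deriv_at_1_root)
  have s1: "-1 < s" using s by simp
  have sign: "cross_deriv_at_1 \<nu> \<ge> 0 \<longleftrightarrow> \<nu> \<ge> s" "cross_deriv_at_1 \<nu> = 0 \<longleftrightarrow> \<nu> = s" if "-1 < \<nu>" for \<nu>
    using cross_deriv_at_1_strict_mono[of \<nu> s] cross_deriv_at_1_strict_mono[of s \<nu>] that s1 s(3)
    by (cases \<nu> s rule: linorder_cases; force)+
  have star: "starlike_on_disc (f_fun \<nu>) \<longleftrightarrow> \<nu> \<ge> s" if "-1 < \<nu>" for \<nu>
    using rapid_alternating_series.starlike_eval_series_iff[OF rapid_alternating_cross_coeff[OF that]] sign(1)[OF that]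
    unfolding f_fun_eq_series[OF that] cross_deriv_at_1_def by simp
  have conv: "close_to_convex_on_disc ((deriv ^^ k) (f_fun \<nu>))" if "-1 < \<nu>" "k \<ge> 1" for \<nu> k
    unfolding f_fun_eq_series[OF that(1)]
    by (rule rapid_alternating_series.close_to_convex_funpow_deriv[OF rapid_alternating_cross_coeff[OF that(1)] that(2)])
  show ?thesis
  proof (intro exI[of _ s] conjI)
    show "{\<nu>::real. (-1::real) < \<nu> \<and>
       of_real (\<nu> - 1) * Bessel_J (of_real \<nu>) 1 * Bessel_I (of_real (\<nu> + 1)) 1
         + of_real (\<nu> - 1) * Bessel_J (of_real (\<nu> + 1)) 1 * Bessel_I (of_real \<nu>) 1
         = Bessel_J (of_real \<nu>) 1 * Bessel_I (of_real \<nu>) 1} = {s}"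
      using bessel_equation_iff sign(2) s1 by blast
  qed (use s star conv close_to_convex_imp_inj_on in blast)+
qed

end
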